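(* Let $H$ be an intermediate function space on a compact convex set $X$ such that $H^\mu$ is determined by extreme points. For $x\in X$, let $\mu=\mu_{H^\mu,x}$ be the unique probability measure on $(\operatorname{ext}X,\mathcal A_{H^\mu})$ such that $m(x)=\int_{\operatorname{ext}X} m\,d\mu$ for all $m\in M(H^\mu)$. Then the following assertions hold. (i) The $\sigma$-algebra $\sigma(\mathcal A_H)$ on $\operatorname{ext}X$ generated by $\mathcal A_H$ is contained in $\mathcal A_{H^\mu}$. (ii) For any $A\in\sigma(\mathcal A_H)$ and $\varepsilon>0$ there exist sets $F,G\subset\operatorname{ext}X$ with $\operatorname{ext}X\setminus F\in\mathcal A_H$ and $G\in\mathcal A_H$ such that $F\subset A\subset G$ and $\mu(G\setminus F)<\varepsilon$.
   Context: A compact convex set is a compact convex subset of a (Hausdorff) locally convex real topological vector space; $\operatorname{ext}X$ is the set of its extreme points. $A_c(X)$ is the space of continuous affine real functions on $X$ and $A_b(X)$ the space of bounded affine real functions on $X$ with the supremum norm. An intermediate function space on $X$ is a (norm-)closed linear subspace $H\subset A_b(X)$ with $A_c(X)\subset H$. It is determined by extreme points if $\inf u(\operatorname{ext}X)\le u\le\sup u(\operatorname{ext}X)$ for every $u\in H$. For a family $F$ of bounded functions on $X$, $F^\mu$ is the smallest family of functions on $X$ containing $F$ and closed with respect to pointwise limits of monotone bounded sequences. If $H$ is an intermediate function space, so is $H^\mu$. Multipliers of an intermediate function space $H$: $M(H)=\{u\in H:\forall a\in H\ \exists b\in H\colon b=u\cdot a\text{ on }\operatorname{ext}X\}$. For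 an intermediate function space $H$ determined by extreme points, $\mathcal A_H=\{[m>0]\cap\operatorname{ext}X: m\in M(H)\}$, where $[m>0]=\{x\in X:m(x)>0\}$; this family is closed under finite intersections and countable unions. If moreover $H^\mu=H$, then $\mathcal A_H$ equals $\{E\subset\operatorname{ext}X:\exists m\in M(H)\colon m|_E=1,\ m|_{\operatorname{ext}X\setminus E}=0\}$, it is a $\sigma$-algebra on $\operatorname{ext}X$, the restrictions to $\operatorname{ext}X$ of elements of $M(H)$ are exactly the bounded $\mathcal A_H$-measurable functions, and for each $x\in X$ there is a unique probability measure $\mu_{H,x}$ on $(\operatorname{ext}X,\mathcal A_H)$ with $m(x)=\int m\,d\mu_{H,x}$ for all $m\in M(H)$. In the claim this is applied to $H^\mu$ in place of $H$. *)

theory Defs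
  imports "HOL-Probability.Probability"
begin

text \<open>Hausdorff locally convex real topological vector spaces. The constant \<open>convex\<close> of the library cannot be
  used inside a class specification, so its definition is written out in the second axiom.\<close>

class locally_convex_space = real_vector + t2_space + topological_ab_group_add +
  assumes tendsto_scaleR_Pair:
      "((\<lambda>p. fst p *\<^sub>R snd p) \<longlongrightarrow> r *\<^sub>R a) (nhds r \<times>\<^sub>F nhds a)"
    and locally_convex_nhds:
      "open U \<Longrightarrow> a \<in> U \<Longrightarrow> \<exists>V. open V \<and> a \<in> V \<and> V \<subseteq> U \<and>
        (\<forall>x\<in>V. \<forall>y\<in>V. \<forall>u\<ge>0. \<forall>v\<ge>0. u + v = 1 \<longrightarrow> u *\<^sub>R x + v *\<^sub>R y \<in> V)"

lemma locally_convex: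
  fixes a :: "'a::locally_convex_space"
  shows "open U \<Longrightarrow> a \<in> U \<Longrightarrow> \<exists>V. open V \<and> convex V \<and> a \<in> V \<and> V \<subseteq> U"
  unfolding convex_def by (drule (1) locally_convex_nhds) (elim exE conjE, intro exI conjI)

instance real_normed_vector \<subseteq> locally_convex_space
proof
  fix r :: real and a :: 'a
  show "((\<lambda>p. fst p *\<^sub>R snd p) \<longlongrightarrow> r *\<^sub>R a) (nhds r \<times>\<^sub>F nhds a)"
    by (intro tendsto_scaleR filterlim_fst filterlim_snd)
next
  fix U :: "'a set" and a :: 'a
  assume "open U" "a \<in> U"
  then obtain e where "e > 0" "ball a e \<subseteq> U"
    using open_contains_ball by blast
  moreover have "convex (ball a e)" by (rule convex_ball)
  ultimately show "\<exists>V. open V \<and> a \<in> V \<and> V \<subseteq> U \<and>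
      (\<forall>x\<in>V. \<forall>y\<in>V. \<forall>u\<ge>0. \<forall>v\<ge>0. u + v = 1 \<longrightarrow> u *\<^sub>R x + v *\<^sub>R y \<in> V)"
    unfolding convex_def by (intro exI[of _ "ball a e"] conjI) simp_all
qed

definition ext :: "'a::real_vector set \<Rightarrow> 'a set" where
  "ext X = {x. x extreme_point_of X}"

text \<open>Real functions on \<open>X\<close> are represented by elements of \<open>extensional X\<close>, so that two of them
  are equal iff they agree on \<open>X\<close>. The bounded ones with the supremum distance form the library's
  metric space \<open>funspace X euclidean_metric\<close>.\<close>

definition affine_fun_on :: "'a::real_vector set \<Rightarrow> ('a \<Rightarrow> real) \<Rightarrow> bool" where
  "affine_fun_on X f \<longleftrightarrow>
     (\<forall>x\<in>X. \<forall>y\<in>X. \<forall>t\<in>{0..1}. f ((1 - t) *\<^sub>R x + t *\<^sub>R y) = (1 - t) * f x + t * f y)"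

definition A_c :: "'a::locally_convex_space set \<Rightarrow> ('a \<Rightarrow> real) set" where
  "A_c X = {f \<in> extensional X. affine_fun_on X f \<and> continuous_on X f}"

definition A_b :: "'a::real_vector set \<Rightarrow> ('a \<Rightarrow> real) set" where
  "A_b X = {f \<in> mspace (funspace X euclidean_metric). affine_fun_on X f}"

definition linear_subspace_on :: "'a set \<Rightarrow> ('a \<Rightarrow> real) set \<Rightarrow> bool" where
  "linear_subspace_on X H \<longleftrightarrow>
     (\<lambda>x\<in>X. 0) \<in> H \<and>
     (\<forall>f\<in>H. \<forall>g\<in>H. (\<lambda>x\<in>X. f x + g x) \<in> H) \<and>
     (\<forall>c. \<forall>f\<in>H. (\<lambda>x\<in>X. c * f x) \<in> H)"

definition intermediate_function_space :: "'a::locally_convex_space set \<Rightarrow> ('a \<Rightarrow> real) set \<Rightarrow> bool" where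
  "intermediate_function_space X H \<longleftrightarrow>
     linear_subspace_on X H \<and> H \<subseteq> A_b X \<and> A_c X \<subseteq> H \<and>
     closedin (mtopology_of (submetric (funspace X euclidean_metric) (A_b X))) H"

definition determined_by_extreme_points :: "'a::real_vector set \<Rightarrow> ('a \<Rightarrow> real) set \<Rightarrow> bool" where
  "determined_by_extreme_points X H \<longleftrightarrow>
     (\<forall>u\<in>H. \<forall>x\<in>X. Inf (u ` ext X) \<le> u x \<and> u x \<le> Sup (u ` ext X))"

inductive_set mu_closure :: "'a set \<Rightarrow> ('a \<Rightarrow> real) set \<Rightarrow> ('a \<Rightarrow> real) set"
  for X :: "'a set" and F :: "('a \<Rightarrow> real) set" where
  base: "f \<in> F \<Longrightarrow> f \<in> mu_closure X F"
| lim: "\<lbrakk>\<And>n. s n \<in> mu_closure X F;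
         (\<forall>x\<in>X. incseq (\<lambda>n. s n x)) \<or> (\<forall>x\<in>X. decseq (\<lambda>n. s n x));
         \<forall>n. \<forall>x\<in>X. \<bar>s n x\<bar> \<le> C;
         f \<in> extensional X; \<forall>x\<in>X. (\<lambda>n. s n x) \<longlonglongrightarrow> f x\<rbrakk>
        \<Longrightarrow> f \<in> mu_closure X F"

definition multipliers :: "'a::real_vector set \<Rightarrow> ('a \<Rightarrow> real) set \<Rightarrow> ('a \<Rightarrow> real) set" where
  "multipliers X H = {u \<in> H. \<forall>a\<in>H. \<exists>b\<in>H. \<forall>x\<in>ext X. b x = u x * a x}"

definition mult_sets :: "'a::real_vector set \<Rightarrow> ('a \<Rightarrow> real) set \<Rightarrow> 'a set set" where
  "mult_sets X H = {{x \<in> X. m x > 0} \<inter> ext X | m. m \<in> multipliers X H}"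

text \<open>The representing measure of \<open>x\<close>; existence and uniqueness hold when \<open>H\<close> is an intermediate
  function space determined by extreme points that is closed under \<open>mu_closure X\<close>.
  Using \<open>has_bochner_integral\<close> requires integrability of \<open>m\<close> as well as the value of its integral.\<close>

definition mult_measure :: "'a::real_vector set \<Rightarrow> ('a \<Rightarrow> real) set \<Rightarrow> 'a \<Rightarrow> 'a measure" where
  "mult_measure X H x =
     (THE M. prob_space M \<and> space M = ext X \<and> sets M = mult_sets X H \<and>
             (\<forall>m\<in>multipliers X H. has_bochner_integral M m (m x)))"

end

theory Submission
  imports Defs
begin

text \<open>Since functions in \<open>H\<close> and \<open>H\<^sup>\<mu>\<close> are determined by their values on \<open>ext X\<close>, one can compute with
  their restrictions there: the restricted multipliers form a uniformly closed algebra, hence are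
  stable under continuous functions by Weierstrass approximation. For \<open>H\<^sup>\<mu>\<close> they are also closed
  under bounded monotone limits, so they contain the indicators of the sets in \<open>\<A>\<close>, and the measure of such
  a set is the value at \<open>x\<close> of the extension of its indicator. A multiplier of \<open>H\<close> multiplies \<open>H\<^sup>\<mu>\<close> into itself
  because, after adding a constant to make it nonnegative, multiplication preserves monotone
  sequences. For regularity, each \<open>[m > 0]\<close> is the increasing union of the sets \<open>[m \<ge> 1/n]\<close>, and the
  sets approximable from inside and outside form a \<open>\<sigma>\<close>-algebra.\<close>

section \<open>Function spaces determined by their values on extreme points\<close>

lemma ext_subset: "ext X \<subseteq> X"
  by (auto simp: ext_def extreme_point_of_def)

lemma ext_imp_mem: "y \<in> ext X \<Longrightarrow> y \<in> X"
  using ext_subset by blast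

text \<open>Collects what \<open>H\<close> and \<open>mu_closure X H\<close> have in common, so that
  the calculus of multipliers is developed once for both. \<open>uniform_limit_V\<close> is norm
  closedness expressed by approximation, and \<open>nonneg_V\<close> is the form in which being
  determined by extreme points is applied.\<close>

locale extremal_function_space =
  fixes X :: "'a::real_vector set" and V :: "('a \<Rightarrow> real) set"
  assumes extensional_V: "V \<subseteq> extensional X"
    and bounded_V: "f \<in> V \<Longrightarrow> \<exists>C. \<forall>x\<in>X. \<bar>f x\<bar> \<le> C"
    and const_V: "(\<lambda>x\<in>X. c) \<in> V"
    and add_V: "f \<in> V \<Longrightarrow> g \<in> V \<Longrightarrow> (\<lambda>x\<in>X. f x + g x) \<in> V"
    and scale_V: "f \<in> V \<Longrightarrow> (\<lambda>x\<in>X. c * f x) \<in> V"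
    and uniform_limit_V:
      "g \<in> extensional X \<Longrightarrow> (\<And>e. e > 0 \<Longrightarrow> \<exists>f\<in>V. \<forall>x\<in>X. \<bar>f x - g x\<bar> \<le> e) \<Longrightarrow> g \<in> V"
    and nonneg_V: "f \<in> V \<Longrightarrow> \<forall>y\<in>ext X. 0 \<le> f y \<Longrightarrow> x \<in> X \<Longrightarrow> 0 \<le> f x"
begin

text \<open>The argument is a total function of which only the values on \<open>ext X\<close> count;
  sums, products and limits can thus be formed pointwise, without restricting to
  \<open>X\<close>.\<close>

definition extendable :: "('a \<Rightarrow> real) \<Rightarrow> bool" where
  "extendable u \<longleftrightarrow> (\<exists>f\<in>V. \<forall>y\<in>ext X. f y = u y)"

definition extend :: "('a \<Rightarrow> real) \<Rightarrow> 'a \<Rightarrow> real" where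
  "extend u = (SOME f. f \<in> V \<and> (\<forall>y\<in>ext X. f y = u y))"

text \<open>The counterpart of \<open>multipliers X V\<close> for functions known only on
  \<open>ext X\<close>. Extendability of \<open>u\<close> itself comes from taking
  \<open>a = 1\<close>.\<close>

definition multiplier :: "('a \<Rightarrow> real) \<Rightarrow> bool" where
  "multiplier u \<longleftrightarrow> (\<forall>a. extendable a \<longrightarrow> extendable (\<lambda>y. u y * a y))"

lemma le_V:
  assumes "f \<in> V" "g \<in> V" "\<forall>y\<in>ext X. f y \<le> g y" "x \<in> X"
  shows "f x \<le> g x"
proof -
  have "(\<lambda>x\<in>X. g x + (\<lambda>x\<in>X. (-1) * f x) x) \<in> V"
    using assms by (intro add_V scale_V)
  from nonneg_V[OF this _ \<open>x \<in> X\<close>] show ?thesis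
    using assms ext_subset[of X] by fastforce
qed

lemma eq_V:
  assumes "f \<in> V" "g \<in> V" "\<forall>y\<in>ext X. f y = g y" "x \<in> X"
  shows "f x = g x"
  using le_V[of f g x] le_V[of g f x] assms by fastforce

text \<open>Constants belong to \<open>V\<close>, so order comparison on \<open>ext X\<close> also
  compares up to a constant. Restriction to \<open>ext X\<close> is therefore isometric for the
  supremum norm.\<close>

lemma abs_diff_le_V:
  assumes "f \<in> V" "g \<in> V" "\<forall>y\<in>ext X. \<bar>f y - g y\<bar> \<le> c" "x \<in> X"
  shows "\<bar>f x - g x\<bar> \<le> c"
proof -
  have "h x \<le> k x + c" if "h \<in> V" "k \<in> V" "\<forall>y\<in>ext X. h y \<le> k y + c" for h k
  proof -
    have "(\<lambda>x\<in>X. k x + (\<lambda>x\<in>X. c) x) \<in> V"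
      using that by (intro add_V const_V)
    from le_V[OF \<open>h \<in> V\<close> this _ \<open>x \<in> X\<close>] show ?thesis
      using that assms ext_subset[of X] by fastforce
  qed
  from this[of f g] this[of g f] show ?thesis
    using assms by fastforce
qed

lemma sum_V:
  assumes "finite I" "\<And>i. i \<in> I \<Longrightarrow> f i \<in> V"
  shows "(\<lambda>x\<in>X. \<Sum>i\<in>I. f i x) \<in> V"
  using assms
proof (induction rule: finite_induct)
  case empty
  show ?case using const_V[of 0] by (simp only: sum.empty)
next
  case (insert i I)
  then have "(\<lambda>x\<in>X. f i x + (\<lambda>x\<in>X. \<Sum>i\<in>I. f i x) x) \<in> V"
    by (intro add_V) auto
  also have "(\<lambda>x\<in>X. f i x + (\<lambda>x\<in>X. \<Sum>i\<in>I. f i x) x) = (\<lambda>x\<in>X. \<Sum>i\<in>insert i I. f i x)"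
    using insert by (auto simp: fun_eq_iff restrict_def)
  finally show ?case .
qed

lemma extendableI: "f \<in> V \<Longrightarrow> (\<And>y. y \<in> ext X \<Longrightarrow> f y = u y) \<Longrightarrow> extendable u"
  by (auto simp: extendable_def)

lemma extendableE:
  assumes "extendable u"
  obtains f where "f \<in> V" "\<And>y. y \<in> ext X \<Longrightarrow> f y = u y"
  using assms by (auto simp: extendable_def)

lemma extend:
  assumes "extendable u"
  shows "extend u \<in> V" "y \<in> ext X \<Longrightarrow> extend u y = u y"
proof -
  have "extend u \<in> V \<and> (\<forall>y\<in>ext X. extend u y = u y)"
    unfolding extend_def
    by (rule someI_ex[where P = "\<lambda>f. f \<in> V \<and> (\<forall>y\<in>ext X. f y = u y)"])
      (use assms in \<open>auto simp: extendable_def\<close>)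
  then show "extend u \<in> V" "y \<in> ext X \<Longrightarrow> extend u y = u y" by auto
qed

lemma extend_eq:
  assumes "f \<in> V" "\<And>y. y \<in> ext X \<Longrightarrow> f y = u y" "x \<in> X"
  shows "extend u x = f x"
  using extendableI[of f u] assms by (intro eq_V extend) (auto simp: extend)

lemma extendable_cong:
  "(\<And>y. y \<in> ext X \<Longrightarrow> u y = v y) \<Longrightarrow> extendable u \<longleftrightarrow> extendable v"
  by (auto simp: extendable_def)

lemma extendable_const: "extendable (\<lambda>y. c)"
  using ext_subset[of X] by (intro extendableI[OF const_V[of c]]) auto

lemma extendable_add:
  assumes "extendable u" "extendable v"
  shows "extendable (\<lambda>y. u y + v y)"
proof -
  obtain f g where "f \<in> V" "\<And>y. y \<in> ext X \<Longrightarrow> f y = u y" "g \<in> V" "\<And>y. y \<in> ext X \<Longrightarrow> g y = v y"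
    using assms by (metis extendableE)
  then show ?thesis
    using ext_subset[of X] by (intro extendableI[OF add_V[of f g]]) auto
qed

lemma extendable_scale:
  assumes "extendable u"
  shows "extendable (\<lambda>y. c * u y)"
proof -
  obtain f where "f \<in> V" "\<And>y. y \<in> ext X \<Longrightarrow> f y = u y"
    using assms by (metis extendableE)
  then show ?thesis
    using ext_subset[of X] by (intro extendableI[OF scale_V[of f c]]) auto
qed

lemma extendable_diff: "extendable u \<Longrightarrow> extendable v \<Longrightarrow> extendable (\<lambda>y. u y - v y)"
  using extendable_add[of u "\<lambda>y. (-1) * v y"] extendable_scale[of v "-1"] by simp

lemma extend_nonneg:
  "extendable u \<Longrightarrow> (\<And>y. y \<in> ext X \<Longrightarrow> 0 \<le> u y) \<Longrightarrow> x \<in> X \<Longrightarrow> 0 \<le> extend u x"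
  by (intro nonneg_V) (auto simp: extend)

lemma extend_const: "x \<in> X \<Longrightarrow> extend (\<lambda>y. c) x = c"
  using extend_eq[OF const_V[of c], of "\<lambda>y. c" x] by (simp add: ext_imp_mem)

lemma extend_add:
  assumes "extendable u" "extendable v" "x \<in> X"
  shows "extend (\<lambda>y. u y + v y) x = extend u x + extend v x"
  using extend_eq[OF add_V[OF extend(1)[OF assms(1)] extend(1)[OF assms(2)]], of "\<lambda>y. u y + v y" x]
    assms by (simp add: extend ext_imp_mem)

lemma extend_scale:
  assumes "extendable u" "x \<in> X"
  shows "extend (\<lambda>y. c * u y) x = c * extend u x"
  using extend_eq[OF scale_V[OF extend(1)[OF assms(1)], of c], of "\<lambda>y. c * u y" x]
    assms by (simp add: extend ext_imp_mem)

lemma extendable_bounded: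
  assumes "extendable u"
  obtains C where "C > 0" "\<And>y. y \<in> ext X \<Longrightarrow> \<bar>u y\<bar> \<le> C"
proof -
  obtain f where f: "f \<in> V" "\<And>y. y \<in> ext X \<Longrightarrow> f y = u y"
    using assms by (metis extendableE)
  obtain C where "\<forall>x\<in>X. \<bar>f x\<bar> \<le> C"
    using bounded_V[OF f(1)] by blast
  then show ?thesis
    using that[of "max C 1"] f ext_subset[of X] by fastforce
qed

text \<open>By \<open>abs_diff_le_V\<close>, extensions of functions that are uniformly Cauchy on
  \<open>ext X\<close> are uniformly Cauchy on all of \<open>X\<close>. Their uniform limit lies in
  \<open>V\<close> and extends \<open>u\<close>.\<close>

lemma extendable_uniform_limit:
  assumes "\<And>e. e > 0 \<Longrightarrow> \<exists>v. extendable v \<and> (\<forall>y\<in>ext X. \<bar>v y - u y\<bar> \<le> e)"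
  shows "extendable u"
proof -
  let ?\<epsilon> = "\<lambda>n. inverse (real (Suc n))"
  have "\<exists>f\<in>V. \<forall>y\<in>ext X. \<bar>f y - u y\<bar> \<le> ?\<epsilon> n" for n
    using assms[of "?\<epsilon> n"] unfolding extendable_def by (metis inverse_positive_iff_positive of_nat_0_less_iff zero_less_Suc)
  then obtain f where f: "\<And>n. f n \<in> V" "\<And>n y. y \<in> ext X \<Longrightarrow> \<bar>f n y - u y\<bar> \<le> ?\<epsilon> n"
    by metis
  have fX: "\<bar>f n x - f k x\<bar> \<le> ?\<epsilon> n + ?\<epsilon> k" if "x \<in> X" for n k x
  proof (rule abs_diff_le_V[OF f(1) f(1) _ that], rule ballI)
    fix y assume "y \<in> ext X"
    from f(2)[OF this, of n] f(2)[OF this, of k] show "\<bar>f n y - f k y\<bar> \<le> ?\<epsilon> n + ?\<epsilon> k" by linarith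
  qed
  have conv: "convergent (\<lambda>n. f n x)" if "x \<in> X" for x
  proof (rule real_Cauchy_convergent, rule CauchyI)
    fix e :: real assume "e > 0"
    then obtain N where N: "?\<epsilon> N < e / 2" using reals_Archimedean[of "e/2"] by auto
    show "\<exists>N. \<forall>m\<ge>N. \<forall>n\<ge>N. norm (f m x - f n x) < e"
    proof (intro exI allI impI)
      fix m n assume "N \<le> m" "N \<le> n"
      then have "?\<epsilon> m \<le> ?\<epsilon> N" "?\<epsilon> n \<le> ?\<epsilon> N" by (auto intro!: le_imp_inverse_le)
      with fX[OF that, of m n] N show "norm (f m x - f n x) < e" unfolding real_norm_def by linarith
    qed
  qed
  define g where "g = (\<lambda>x\<in>X. lim (\<lambda>n. f n x))"
  have lim: "(\<lambda>n. f n x) \<longlonglongrightarrow> g x" if "x \<in> X" for x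
    using conv[OF that] that by (simp add: g_def convergent_LIMSEQ_iff)
  have fg: "\<bar>f n x - g x\<bar> \<le> ?\<epsilon> n" if "x \<in> X" for x n
  proof (rule LIMSEQ_le)
    show "(\<lambda>k. \<bar>f n x - f k x\<bar>) \<longlonglongrightarrow> \<bar>f n x - g x\<bar>"
      by (intro tendsto_intros lim that)
    have "(\<lambda>k. ?\<epsilon> n + ?\<epsilon> k) \<longlonglongrightarrow> ?\<epsilon> n + 0"
      by (intro tendsto_add tendsto_const LIMSEQ_inverse_real_of_nat)
    then show "(\<lambda>k. ?\<epsilon> n + ?\<epsilon> k) \<longlonglongrightarrow> ?\<epsilon> n" by simp
  qed (use fX[OF that] in auto)
  have "g \<in> V"
  proof (rule uniform_limit_V)
    show "g \<in> extensional X" by (simp add: g_def)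
    fix e :: real assume "e > 0"
    then obtain N where N: "?\<epsilon> N < e" using reals_Archimedean[of e] by auto
    show "\<exists>f\<in>V. \<forall>x\<in>X. \<bar>f x - g x\<bar> \<le> e"
      using f(1)[of N] fg[of _ N] N by (meson less_le_trans less_imp_le order_trans)
  qed
  then show ?thesis
  proof (rule extendableI)
    fix y assume y: "y \<in> ext X"
    have "(\<lambda>n. f n y - u y) \<longlonglongrightarrow> 0"
      by (rule Lim_null_comparison[OF _ LIMSEQ_inverse_real_of_nat]) (use f(2)[OF y] in auto)
    then have "(\<lambda>n. f n y) \<longlonglongrightarrow> u y" by (simp add: LIM_zero_iff)
    moreover have "y \<in> X" using y ext_subset by auto
    ultimately show "g y = u y" using lim LIMSEQ_unique by blast
  qed
qed

section \<open>Multipliers and their functional calculus\<close>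

lemma multiplierD: "multiplier u \<Longrightarrow> extendable a \<Longrightarrow> extendable (\<lambda>y. u y * a y)"
  by (simp add: multiplier_def)

lemma multiplier_extendable: "multiplier u \<Longrightarrow> extendable u"
  using multiplierD[OF _ extendable_const[of 1]] by simp

lemma multiplier_cong:
  assumes "\<And>y. y \<in> ext X \<Longrightarrow> u y = v y"
  shows "multiplier u \<longleftrightarrow> multiplier v"
  unfolding multiplier_def
  by (intro all_cong1 imp_cong refl extendable_cong) (simp add: assms)

lemma multiplier_const: "multiplier (\<lambda>y. c)"
  by (simp add: multiplier_def extendable_scale)

lemma multiplier_add: "multiplier u \<Longrightarrow> multiplier v \<Longrightarrow> multiplier (\<lambda>y. u y + v y)"
  by (simp add: multiplier_def distrib_right extendable_add)

lemma multiplier_diff: "multiplier u \<Longrightarrow> multiplier v \<Longrightarrow> multiplier (\<lambda>y. u y - v y)"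
  by (simp add: multiplier_def left_diff_distrib extendable_diff)

lemma multiplier_mult: "multiplier u \<Longrightarrow> multiplier v \<Longrightarrow> multiplier (\<lambda>y. u y * v y)"
  by (simp add: multiplier_def mult.assoc)

lemma multiplier_power: "multiplier u \<Longrightarrow> multiplier (\<lambda>y. u y ^ n)"
  by (induction n) (simp_all add: multiplier_const multiplier_mult)

lemma multiplier_sum:
  "(\<And>i. i \<in> I \<Longrightarrow> multiplier (u i)) \<Longrightarrow> multiplier (\<lambda>y. \<Sum>i\<in>I. u i y)"
  by (induction I rule: infinite_finite_induct) (simp_all add: multiplier_const multiplier_add)

text \<open>Extendable functions are bounded on \<open>ext X\<close>, so multiplication by a fixed
  one carries uniform approximation of \<open>u\<close> over to the product.\<close>

lemma multiplier_uniform_limit: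
  assumes "\<And>e. e > 0 \<Longrightarrow> \<exists>v. multiplier v \<and> (\<forall>y\<in>ext X. \<bar>v y - u y\<bar> \<le> e)"
  shows "multiplier u"
  unfolding multiplier_def
proof (intro allI impI)
  fix a assume a: "extendable a"
  obtain C where C: "C > 0" "\<And>y. y \<in> ext X \<Longrightarrow> \<bar>a y\<bar> \<le> C"
    using extendable_bounded[OF a] by blast
  show "extendable (\<lambda>y. u y * a y)"
  proof (rule extendable_uniform_limit)
    fix e :: real assume "e > 0"
    then obtain v where v: "multiplier v" "\<forall>y\<in>ext X. \<bar>v y - u y\<bar> \<le> e / C"
      using assms[of "e / C"] C by auto
    have "\<bar>v y * a y - u y * a y\<bar> \<le> e" if "y \<in> ext X" for y
    proof -
      have "\<bar>v y * a y - u y * a y\<bar> = \<bar>v y - u y\<bar> * \<bar>a y\<bar>"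
        by (simp add: abs_mult[symmetric] left_diff_distrib)
      also have "\<dots> \<le> e / C * C"
        using v C that \<open>e > 0\<close> by (intro mult_mono) auto
      finally show ?thesis using C by simp
    qed
    then show "\<exists>v. extendable v \<and> (\<forall>y\<in>ext X. \<bar>v y - u y * a y\<bar> \<le> e)"
      using multiplierD[OF v(1) a] by blast
  qed
qed

lemma multiplier_polynomial:
  fixes p :: "real \<Rightarrow> real"
  assumes "real_polynomial_function p" "multiplier u"
  shows "multiplier (\<lambda>y. p (u y))"
  using assms(1)
proof induction
  case (linear f)
  \<comment> \<open>A linear map on the reals is multiplication by its value at
    \<open>1\<close>.\<close>
  then have "f t = f 1 * t" for t
    using linear_simps(5)[of f t 1] by simp
  then have "(\<lambda>y. f (u y)) = (\<lambda>y. f 1 * u y)"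
    by blast
  then show ?case
    using multiplier_mult[OF multiplier_const[of "f 1"] assms(2)] by simp
qed (auto intro: multiplier_const multiplier_add multiplier_mult)

text \<open>All values of \<open>u\<close> on \<open>ext X\<close> lie in a compact interval, where
  polynomials approximate \<open>\<phi>\<close> uniformly.\<close>

lemma multiplier_continuous:
  fixes \<phi> :: "real \<Rightarrow> real"
  assumes "continuous_on UNIV \<phi>" "multiplier u"
  shows "multiplier (\<lambda>y. \<phi> (u y))"
proof (rule multiplier_uniform_limit)
  obtain C where C: "\<And>y. y \<in> ext X \<Longrightarrow> \<bar>u y\<bar> \<le> C"
    using extendable_bounded[OF multiplier_extendable[OF assms(2)]] by blast
  fix e :: real assume "e > 0"
  then obtain p where p: "real_polynomial_function p" "\<And>t. t \<in> {-C..C} \<Longrightarrow> \<bar>\<phi> t - p t\<bar> < e"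
    using Stone_Weierstrass_real_polynomial_function
      [OF compact_Icc continuous_on_subset[OF assms(1) subset_UNIV], of e "-C" C]
    by blast
  have "\<bar>p (u y) - \<phi> (u y)\<bar> \<le> e" if "y \<in> ext X" for y
    using p(2)[of "u y"] C[OF that] by (simp add: abs_le_iff) linarith
  then show "\<exists>v. multiplier v \<and> (\<forall>y\<in>ext X. \<bar>v y - \<phi> (u y)\<bar> \<le> e)"
    using multiplier_polynomial[OF p(1) assms(2)] by blast
qed

section \<open>Positivity sets of multipliers\<close>

lemma multipliersD:
  assumes "m \<in> multipliers X V"
  shows "m \<in> V" "multiplier m"
proof -
  show "m \<in> V" using assms by (simp add: multipliers_def)
  show "multiplier m"
    unfolding multiplier_def
  proof (intro allI impI)
    fix a assume "extendable a"
    then obtain f where f: "f \<in> V" "\<And>y. y \<in> ext X \<Longrightarrow> f y = a y" by (metis extendableE)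
    with assms obtain b where "b \<in> V" "\<forall>y\<in>ext X. b y = m y * f y"
      by (auto simp: multipliers_def)
    with f show "extendable (\<lambda>y. m y * a y)" by (auto intro: extendableI)
  qed
qed

lemma multipliersI:
  assumes "m \<in> V" "multiplier m"
  shows "m \<in> multipliers X V"
  using assms by (auto simp: multipliers_def multiplier_def extendable_def)

text \<open>Frees the family from extensions to \<open>X\<close>: witnesses may be any functions
  that are multipliers on \<open>ext X\<close>, since \<open>extend\<close> turns them into elements
  of \<open>multipliers X V\<close>.\<close>

lemma mult_sets_iff: "A \<in> mult_sets X V \<longleftrightarrow> (\<exists>u. multiplier u \<and> A = {y \<in> ext X. 0 < u y})"
proof
  assume "A \<in> mult_sets X V"
  then obtain m where "m \<in> multipliers X V" "A = {x \<in> X. m x > 0} \<inter> ext X"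
    by (auto simp: mult_sets_def)
  then show "\<exists>u. multiplier u \<and> A = {y \<in> ext X. 0 < u y}"
    using multipliersD(2) ext_subset[of X] by blast
next
  assume "\<exists>u. multiplier u \<and> A = {y \<in> ext X. 0 < u y}"
  then obtain u where u: "multiplier u" "A = {y \<in> ext X. 0 < u y}" by blast
  note * = extend[OF multiplier_extendable[OF u(1)]]
  have "multiplier (extend u)"
    using u(1) *(2) by (subst multiplier_cong[of _ u]) auto
  with * have "extend u \<in> multipliers X V" by (auto intro: multipliersI)
  moreover have "A = {x \<in> X. extend u x > 0} \<inter> ext X"
    using u(2) * ext_subset[of X] by auto
  ultimately show "A \<in> mult_sets X V"
    by (auto simp: mult_sets_def)
qed

lemma mult_sets_subset: "A \<in> mult_sets X V \<Longrightarrow> A \<subseteq> ext X"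
  by (auto simp: mult_sets_def)

lemma mult_sets_empty: "{} \<in> mult_sets X V"
  unfolding mult_sets_iff by (intro exI[of _ "\<lambda>y. 0"]) (auto intro: multiplier_const)

lemma mult_sets_space: "ext X \<in> mult_sets X V"
  unfolding mult_sets_iff by (intro exI[of _ "\<lambda>y. 1"]) (auto intro: multiplier_const)

text \<open>Truncating a witness to the interval from \<open>0\<close> to \<open>1\<close> is a
  continuous operation that leaves its positivity set unchanged.\<close>

lemma mult_setsE:
  assumes "A \<in> mult_sets X V"
  obtains u where "multiplier u" "A = {y \<in> ext X. 0 < u y}" "\<And>y. 0 \<le> u y" "\<And>y. u y \<le> 1"
proof -
  obtain u where u: "multiplier u" "A = {y \<in> ext X. 0 < u y}"
    using assms unfolding mult_sets_iff by blast
  have "multiplier (\<lambda>y. min 1 (max 0 (u y)))"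
    by (rule multiplier_continuous[OF _ u(1)]) (intro continuous_intros)
  then show ?thesis
    by (rule that) (auto simp: u(2))
qed

lemma mult_sets_Int:
  assumes "A \<in> mult_sets X V" "B \<in> mult_sets X V"
  shows "A \<inter> B \<in> mult_sets X V"
proof -
  obtain u where u: "multiplier u" "A = {y \<in> ext X. 0 < u y}" "\<And>y. 0 \<le> u y"
    using mult_setsE[OF assms(1)] by metis
  obtain v where v: "multiplier v" "B = {y \<in> ext X. 0 < v y}" "\<And>y. 0 \<le> v y"
    using mult_setsE[OF assms(2)] by metis
  have "0 < u y * v y \<longleftrightarrow> 0 < u y \<and> 0 < v y" for y
    using u(3)[of y] v(3)[of y] by (auto simp: zero_less_mult_iff)
  then have "A \<inter> B = {y \<in> ext X. 0 < u y * v y}"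
    using u(2) v(2) by auto
  then show ?thesis
    using multiplier_mult[OF u(1) v(1)] by (auto simp: mult_sets_iff)
qed

text \<open>With witnesses between \<open>0\<close> and \<open>1\<close>, the series with weights
  \<open>(1/2)^n\<close> converges uniformly, so its sum is a multiplier. The sum is positive
  exactly where some term is.\<close>

lemma mult_sets_UN:
  fixes A :: "nat \<Rightarrow> 'a set"
  assumes "\<And>n. A n \<in> mult_sets X V"
  shows "(\<Union>n. A n) \<in> mult_sets X V"
proof -
  have "\<exists>u. multiplier u \<and> A n = {y \<in> ext X. 0 < u y} \<and> (\<forall>y. 0 \<le> u y \<and> u y \<le> 1)" for n
    using mult_setsE[OF assms[of n]] by metis
  then obtain u where u: "\<And>n. multiplier (u n)" "\<And>n. A n = {y \<in> ext X. 0 < u n y}"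
    "\<And>n y. 0 \<le> u n y" "\<And>n y. u n y \<le> 1"
    by metis
  let ?t = "\<lambda>y n. (1/2)^n * u n y"
  have summ: "summable (?t y)" for y
    by (rule summable_comparison_test'[of "\<lambda>n. (1/2)^n"]) (auto simp: u abs_mult intro: mult_left_le)
  have "multiplier (\<lambda>y. suminf (?t y))"
  proof (rule multiplier_uniform_limit)
    fix e :: real assume "e > 0"
    then have "e / 2 > 0" by simp
    \<comment> \<open>The tail of the series from index \<open>N\<close> on is at most
      \<open>2 * (1/2)^N\<close>.\<close>
    then obtain N where N: "(1/2::real)^N < e/2" using real_arch_pow_inv[of "e/2" "1/2"] by auto
    have "\<bar>(\<Sum>n<N. ?t y n) - suminf (?t y)\<bar> \<le> e" for y
    proof -
      have s: "summable (\<lambda>n. ?t y (n + N))" using summ by (rule summable_ignore_initial_segment)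
      have g: "(\<lambda>n. (1/2::real)^N * (1/2)^n) sums ((1/2)^N * 2)"
        using geometric_sums[of "1/2::real"] by (intro sums_mult) simp
      have "suminf (?t y) - (\<Sum>n<N. ?t y n) = (\<Sum>n. ?t y (n + N))"
        using suminf_split_initial_segment[OF summ[of y], of N] by simp
      moreover have "(\<Sum>n. ?t y (n + N)) \<le> (\<Sum>n. (1/2)^N * (1/2)^n)"
      proof (rule suminf_le[OF _ s sums_summable[OF g]])
        fix n
        have "?t y (n + N) \<le> (1/2)^(n+N)" by (rule mult_left_le) (auto simp: u)
        then show "?t y (n + N) \<le> (1/2)^N * (1/2)^n" by (simp only: power_add mult.commute)
      qed
      moreover have "0 \<le> (\<Sum>n. ?t y (n + N))"
        by (rule suminf_nonneg[OF s]) (simp add: u)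
      ultimately show ?thesis using N sums_unique[OF g] by simp
    qed
    moreover have "multiplier (\<lambda>y. \<Sum>n<N. ?t y n)"
      by (intro multiplier_sum multiplier_mult multiplier_const u)
    ultimately show "\<exists>v. multiplier v \<and> (\<forall>y\<in>ext X. \<bar>v y - suminf (?t y)\<bar> \<le> e)" by blast
  qed
  moreover have "(0 < suminf (?t y)) = (\<exists>n. 0 < u n y)" for y
    by (subst suminf_pos_iff[OF summ]) (auto simp: u zero_less_mult_iff)
  then have "(\<Union>n. A n) = {y \<in> ext X. 0 < suminf (?t y)}"
    using u(2) by auto
  ultimately show ?thesis
    by (auto simp: mult_sets_iff)
qed

lemma mult_sets_inner:
  assumes "A \<in> mult_sets X V"
  obtains C :: "nat \<Rightarrow> 'a set"
  where "\<And>n. C n \<subseteq> ext X" "\<And>n. ext X - C n \<in> mult_sets X V" "incseq C" "A = (\<Union>n. C n)"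
proof -
  obtain u where u: "multiplier u" "A = {y \<in> ext X. 0 < u y}"
    using assms unfolding mult_sets_iff by blast
  \<comment> \<open>\<open>Suc n\<close> keeps every threshold positive; since
    \<open>inverse 0 = 0\<close>, a threshold for index \<open>0\<close> would admit points where
    \<open>u\<close> vanishes.\<close>
  define C where "C n = {y \<in> ext X. inverse (real (Suc n)) \<le> u y}" for n
  show thesis
  proof (rule that)
    show "C n \<subseteq> ext X" for n by (auto simp: C_def)
    have "ext X - C n = {y \<in> ext X. 0 < inverse (real (Suc n)) - u y}" for n
      by (auto simp: C_def)
    then show "ext X - C n \<in> mult_sets X V" for n
      using multiplier_diff[OF multiplier_const u(1), of "inverse (real (Suc n))"]
      unfolding mult_sets_iff by blast
    have "inverse (real (Suc n)) \<le> inverse (real (Suc m))" if "m \<le> n" for m n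
      using that by (intro le_imp_inverse_le) auto
    then show "incseq C"
      unfolding incseq_def C_def by (blast intro: order_trans)
    show "A = (\<Union>n. C n)"
    proof safe
      fix y assume "y \<in> A"
      then obtain n where "inverse (real (Suc n)) < u y" using u reals_Archimedean[of "u y"] by auto
      with \<open>y \<in> A\<close> u show "y \<in> (\<Union>n. C n)" by (auto simp: C_def intro!: exI[of _ n])
    next
      fix y n assume "y \<in> C n"
      moreover have "0 < inverse (real (Suc n))" by simp
      ultimately show "y \<in> A" unfolding C_def u(2) by (metis (mono_tags, lifting) less_le_trans mem_Collect_eq)
    qed
  qed
qed

end

section \<open>Function spaces closed under bounded monotone limits\<close>

locale monotone_extremal_function_space = extremal_function_space +
  assumes incseq_limit_V:
    "(\<And>n. s n \<in> V) \<Longrightarrow> \<forall>x\<in>X. incseq (\<lambda>n. s n x) \<Longrightarrow> \<forall>n. \<forall>x\<in>X. \<bar>s n x\<bar> \<le> C \<Longrightarrow>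
     f \<in> extensional X \<Longrightarrow> \<forall>x\<in>X. (\<lambda>n. s n x) \<longlonglongrightarrow> f x \<Longrightarrow> f \<in> V"
begin

text \<open>Monotonicity and the upper bound pass from \<open>ext X\<close> to \<open>X\<close> by
  \<open>le_V\<close>, while the first term bounds the sequence from below. Hence the limit exists
  on \<open>X\<close> and belongs to \<open>V\<close>.\<close>

lemma incseq_ext_limit_V:
  assumes f: "\<And>n. f n \<in> V"
    and inc: "\<And>y. y \<in> ext X \<Longrightarrow> incseq (\<lambda>n. f n y)"
    and bd: "\<And>n y. y \<in> ext X \<Longrightarrow> f n y \<le> C"
  obtains g where "g \<in> V" "\<And>x. x \<in> X \<Longrightarrow> (\<lambda>n. f n x) \<longlonglongrightarrow> g x"
proof -
  obtain C0 where C0: "\<And>x. x \<in> X \<Longrightarrow> \<bar>f 0 x\<bar> \<le> C0"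
    using bounded_V[OF f] by blast
  have incX: "incseq (\<lambda>n. f n x)" if "x \<in> X" for x
    using inc by (intro incseq_SucI le_V f that) (auto simp: incseq_Suc_iff)
  have bdX: "f n x \<le> C" if "x \<in> X" for n x
    using le_V[OF f[of n] const_V[of C] _ that] bd that by (simp add: ext_imp_mem)
  have abs_bdX: "\<bar>f n x\<bar> \<le> \<bar>C\<bar> + \<bar>C0\<bar>" if "x \<in> X" for n x
    using bdX[OF that, of n] C0[OF that] incseqD[OF incX[OF that], of 0 n] by auto
  define g where "g = (\<lambda>x\<in>X. lim (\<lambda>n. f n x))"
  have lim: "(\<lambda>n. f n x) \<longlonglongrightarrow> g x" if "x \<in> X" for x
  proof -
    have "convergent (\<lambda>n. f n x)"
      using incseq_convergent[OF incX[OF that], of C] bdX[OF that] unfolding convergent_def by metis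
    then show ?thesis using that by (simp add: g_def convergent_LIMSEQ_iff)
  qed
  have "g \<in> V"
    by (rule incseq_limit_V[of f "\<bar>C\<bar> + \<bar>C0\<bar>"]) (use f incX abs_bdX lim in \<open>auto simp: g_def\<close>)
  with lim that show thesis by blast
qed

text \<open>Monotone convergence for the functional \<open>u \<mapsto> extend u x\<close>. Countable
  additivity of the representing measure rests on it.\<close>

lemma extend_incseq_limit:
  assumes s: "\<And>n. extendable (s n)"
    and inc: "\<And>y. y \<in> ext X \<Longrightarrow> incseq (\<lambda>n. s n y)"
    and bd: "\<And>n y. y \<in> ext X \<Longrightarrow> s n y \<le> C"
    and lim: "\<And>y. y \<in> ext X \<Longrightarrow> (\<lambda>n. s n y) \<longlonglongrightarrow> u y"
  shows "extendable u" "x \<in> X \<Longrightarrow> (\<lambda>n. extend (s n) x) \<longlonglongrightarrow> extend u x"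
proof -
  obtain g where g: "g \<in> V" "\<And>x. x \<in> X \<Longrightarrow> (\<lambda>n. extend (s n) x) \<longlonglongrightarrow> g x"
    by (rule incseq_ext_limit_V[of "\<lambda>n. extend (s n)" C])
      (use inc bd in \<open>auto simp: extend[OF s] incseq_def\<close>)
  have gu: "g y = u y" if "y \<in> ext X" for y
  proof -
    have "(\<lambda>n. s n y) \<longlonglongrightarrow> g y"
      using g(2)[of y] that ext_subset[of X] by (auto simp: extend[OF s])
    then show ?thesis using lim[OF that] LIMSEQ_unique by blast
  qed
  with g(1) show "extendable u" by (rule extendableI)
  show "(\<lambda>n. extend (s n) x) \<longlonglongrightarrow> extend u x" if "x \<in> X"
    using g(2)[OF that] extend_eq[OF g(1) gu that] by simp
qed

text \<open>Replacing \<open>a\<close> by the nonnegative \<open>a + K\<close> makes multiplication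
  preserve increasing sequences. The product with the limit then extends, and so does its difference
  with \<open>K * u\<close>.\<close>

lemma multiplier_incseq_limit:
  assumes s: "\<And>n. multiplier (s n)"
    and inc: "\<And>y. y \<in> ext X \<Longrightarrow> incseq (\<lambda>n. s n y)"
    and bd: "\<And>n y. y \<in> ext X \<Longrightarrow> s n y \<le> C"
    and lim: "\<And>y. y \<in> ext X \<Longrightarrow> (\<lambda>n. s n y) \<longlonglongrightarrow> u y"
  shows "multiplier u"
  unfolding multiplier_def
proof (intro allI impI)
  fix a assume a: "extendable a"
  obtain K where K: "K > 0" "\<And>y. y \<in> ext X \<Longrightarrow> \<bar>a y\<bar> \<le> K"
    using extendable_bounded[OF a] by blast
  have nn: "0 \<le> a y + K" "a y + K \<le> 2 * K" if "y \<in> ext X" for y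
    using K(2)[OF that] by auto
  have "extendable (\<lambda>y. u y * (a y + K))"
  \<comment> \<open>The bound \<open>C\<close> may be negative, hence its absolute value;
    \<open>2 * K\<close> bounds the shifted factor.\<close>
  proof (rule extend_incseq_limit(1)[of "\<lambda>n y. s n y * (a y + K)" "\<bar>C\<bar> * (2 * K)"])
    show "extendable (\<lambda>y. s n y * (a y + K))" for n
      by (intro multiplierD[OF s] extendable_add a extendable_const)
    fix y assume y: "y \<in> ext X"
    show "incseq (\<lambda>n. s n y * (a y + K))"
      using inc[OF y] nn[OF y] by (auto simp: incseq_def intro: mult_right_mono)
    show "s n y * (a y + K) \<le> \<bar>C\<bar> * (2 * K)" for n
      using bd[OF y, of n] nn[OF y] by (intro mult_mono) auto
    show "(\<lambda>n. s n y * (a y + K)) \<longlonglongrightarrow> u y * (a y + K)"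
      by (intro tendsto_intros lim y)
  qed
  moreover have "extendable u"
    by (rule extend_incseq_limit(1)[of s C]) (use assms multiplier_extendable in auto)
  ultimately have "extendable (\<lambda>y. u y * (a y + K) - K * u y)"
    by (intro extendable_diff extendable_scale)
  then show "extendable (\<lambda>y. u y * a y)"
    by (simp add: algebra_simps)
qed

text \<open>If \<open>0 \<le> u \<le> 1\<close>, then \<open>1 - (1 - u) ^ n\<close> increases to the indicator of the set where \<open>u > 0\<close>.\<close>
lemma multiplier_indicator:
  assumes "A \<in> mult_sets X V"
  shows "multiplier (indicator A)"
proof -
  obtain u where u: "multiplier u" "A = {y \<in> ext X. 0 < u y}" "\<And>y. 0 \<le> u y" "\<And>y. u y \<le> 1"
    using mult_setsE[OF assms] by metis
  show ?thesis
  proof (rule multiplier_incseq_limit[of "\<lambda>n y. 1 - (1 - u y) ^ n" 1])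
    show "multiplier (\<lambda>y. 1 - (1 - u y) ^ n)" for n
      by (intro multiplier_diff multiplier_power multiplier_const u)
    fix y assume y: "y \<in> ext X"
    show "incseq (\<lambda>n. 1 - (1 - u y) ^ n)"
      using u(3,4)[of y] by (auto simp: incseq_def intro!: power_decreasing)
    show "1 - (1 - u y) ^ n \<le> 1" for n
      using u(4)[of y] by simp
    show "(\<lambda>n. 1 - (1 - u y) ^ n) \<longlonglongrightarrow> indicator A y"
    proof (cases "u y = 0")
      case True
      then show ?thesis using u(2) by simp
    next
      case False
      then have pos: "0 < u y" using u(3)[of y] by simp
      then have "(\<lambda>n. 1 - (1 - u y) ^ n) \<longlonglongrightarrow> 1 - 0"
        using u(4)[of y] by (intro tendsto_diff tendsto_const LIMSEQ_realpow_zero) auto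
      then show ?thesis using pos y u(2) by (simp add: indicator_def)
    qed
  qed
qed

text \<open>Turns closure under complements into the fact that \<open>1 - indicator A\<close> is a
  multiplier.\<close>

lemma mult_sets_iff_indicator:
  "A \<in> mult_sets X V \<longleftrightarrow> A \<subseteq> ext X \<and> multiplier (indicator A)"
proof
  assume "A \<subseteq> ext X \<and> multiplier (indicator A)"
  moreover from this have "A = {y \<in> ext X. (0::real) < indicator A y}"
    by (auto simp: indicator_def split: if_splits)
  ultimately show "A \<in> mult_sets X V"
    unfolding mult_sets_iff by blast
qed (auto intro: multiplier_indicator dest: mult_sets_subset)

lemma sigma_algebra_mult_sets: "sigma_algebra (ext X) (mult_sets X V)"
  unfolding sigma_algebra_iff2
proof (intro conjI ballI allI impI)
  show "mult_sets X V \<subseteq> Pow (ext X)" using mult_sets_subset by blast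
  show "{} \<in> mult_sets X V" by (rule mult_sets_empty)
next
  fix A assume "A \<in> mult_sets X V"
  then have "multiplier (\<lambda>y. 1 - indicator A y)"
    by (intro multiplier_diff multiplier_const multiplier_indicator)
  then have "multiplier (indicator (ext X - A))"
    by (subst multiplier_cong[of _ "\<lambda>y. 1 - indicator A y"]) (auto simp: indicator_def)
  then show "ext X - A \<in> mult_sets X V"
    by (auto simp: mult_sets_iff_indicator)
next
  fix A :: "nat \<Rightarrow> 'a set" assume "range A \<subseteq> mult_sets X V"
  then show "(\<Union>i. A i) \<in> mult_sets X V"
    by (intro mult_sets_UN) auto
qed

text \<open>For finitely many disjoint sets the sum of the extended indicators agrees on
  \<open>ext X\<close> with the indicator of the union, so it equals its extension on
  \<open>X\<close>. Monotone convergence then handles the increasing partial unions.\<close>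

lemma extend_indicator_sums:
  fixes A :: "nat \<Rightarrow> 'a set"
  assumes A: "range A \<subseteq> mult_sets X V" "disjoint_family A" and x: "x \<in> X"
  shows "(\<lambda>i. extend (indicator (A i)) x) sums extend (indicator (\<Union>i. A i)) x"
proof -
  interpret sigma_algebra "ext X" "mult_sets X V" by (rule sigma_algebra_mult_sets)
  have AN: "(\<Union>i<n. A i) \<in> mult_sets X V" for n
    using A(1) by (intro finite_UN) auto
  have ex: "extendable (indicator B)" if "B \<in> mult_sets X V" for B
    using that by (intro multiplier_extendable multiplier_indicator)
  have "(\<lambda>n. extend (indicator (\<Union>i<n. A i)) x) \<longlonglongrightarrow> extend (indicator (\<Union>i. A i)) x"
  proof (rule extend_incseq_limit(2)[of _ 1, OF ex[OF AN] _ _ _ x])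
    show "incseq (\<lambda>n. indicator (\<Union>i<n. A i) y :: real)" for y
      by (rule incseq_SucI) (auto simp: indicator_def)
    show "indicator (\<Union>i<n. A i) y \<le> (1::real)" for n y
      by (simp add: indicator_def)
    show "(\<lambda>n. indicator (\<Union>i<n. A i) y :: real) \<longlonglongrightarrow> indicator (\<Union>i. A i) y" for y
      by (rule LIMSEQ_indicator_UN)
  qed
  moreover have "extend (indicator (\<Union>i<n. A i)) x = (\<Sum>i<n. extend (indicator (A i)) x)" for n
  proof -
    have "(\<lambda>x\<in>X. \<Sum>i<n. extend (indicator (A i)) x) \<in> V"
      using A(1) by (intro sum_V extend ex) auto
    moreover have "(\<Sum>i<n. extend (indicator (A i)) y) = indicator (\<Union>i<n. A i) y" if y: "y \<in> ext X" for y
    proof -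
      have "disjoint_family_on A {..<n}"
        using A(2) by (rule disjoint_family_on_mono[rotated]) simp
      then have "indicator (\<Union>i<n. A i) y = (\<Sum>i<n. indicator (A i) y :: real)"
        by (rule indicator_UN_disjoint[rotated]) simp
      also have "\<dots> = (\<Sum>i<n. extend (indicator (A i)) y)"
        using A(1) y by (intro sum.cong refl extend(2)[symmetric] ex) auto
      finally show ?thesis ..
    qed
    ultimately show ?thesis
      using extend_eq[of _ "indicator (\<Union>i<n. A i)" x] x ext_subset[of X] by fastforce
  qed
  ultimately show ?thesis by (simp add: sums_def)
qed

section \<open>Construction and uniqueness of the representing measure\<close>

definition rep_measure :: "'a \<Rightarrow> 'a measure" where
  "rep_measure x = measure_of (ext X) (mult_sets X V) (\<lambda>A. ennreal (extend (indicator A) x))"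

lemma space_rep_measure: "space (rep_measure x) = ext X"
  unfolding rep_measure_def by (rule space_measure_of) (auto dest: mult_sets_subset)

lemma sets_rep_measure: "sets (rep_measure x) = mult_sets X V"
  unfolding rep_measure_def by (rule sigma_algebra.sets_measure_of_eq[OF sigma_algebra_mult_sets])

lemma emeasure_rep_measure:
  assumes "x \<in> X" "A \<in> mult_sets X V"
  shows "emeasure (rep_measure x) A = ennreal (extend (indicator A) x)"
  unfolding rep_measure_def
proof (rule emeasure_measure_of_sigma[OF sigma_algebra_mult_sets])
  have nn: "0 \<le> extend (indicator B) x" if "B \<in> mult_sets X V" for B
    using that assms(1) by (intro extend_nonneg multiplier_extendable multiplier_indicator) auto
  have "extend (indicator {}) x = 0"
    using extend_const[OF assms(1), of 0] by (simp add: indicator_def[abs_def])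
  then show "positive (mult_sets X V) (\<lambda>A. ennreal (extend (indicator A) x))"
    by (simp add: positive_def)
  show "countably_additive (mult_sets X V) (\<lambda>A. ennreal (extend (indicator A) x))"
    unfolding countably_additive_def
  proof (intro allI impI suminf_ennreal_eq)
    fix A :: "nat \<Rightarrow> 'a set" assume A: "range A \<subseteq> mult_sets X V" "disjoint_family A"
    then show "0 \<le> extend (indicator (A i)) x" for i
      by (intro nn) auto
    show "(\<lambda>i. extend (indicator (A i)) x) sums extend (indicator (\<Union>i. A i)) x"
      by (rule extend_indicator_sums[OF A assms(1)])
  qed
qed (fact assms)

lemma prob_space_rep_measure:
  assumes "x \<in> X"
  shows "prob_space (rep_measure x)"
proof
  have "extend (indicator (ext X)) x = 1"
    using extend_eq[OF const_V[of 1], of "indicator (ext X)" x] assms by (simp add: ext_imp_mem)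
  then show "emeasure (rep_measure x) (space (rep_measure x)) = 1"
    by (simp add: space_rep_measure emeasure_rep_measure[OF assms mult_sets_space])
qed

lemma multiplier_measurable:
  assumes "multiplier u"
  shows "u \<in> borel_measurable (rep_measure x)"
  unfolding borel_measurable_iff_greater space_rep_measure sets_rep_measure
proof
  fix a
  have "multiplier (\<lambda>y. u y - a)"
    by (intro multiplier_diff multiplier_const assms)
  then show "{y \<in> ext X. a < u y} \<in> mult_sets X V"
    unfolding mult_sets_iff by force
qed

text \<open>The standard induction on nonnegative measurable functions. Being a multiplier is proved
  alongside the integral formula because \<open>extend u\<close> is meaningful only for extendable
  \<open>u\<close>.\<close>

lemma integral_rep_measure:
  assumes "u \<in> borel_measurable (rep_measure x)" "\<And>y. 0 \<le> u y"
    and x: "x \<in> X" and "\<And>y. y \<in> ext X \<Longrightarrow> u y \<le> C"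
  shows "multiplier u \<and> integral\<^sup>L (rep_measure x) u = extend u x"
  using assms(1,2,4)
proof (induction arbitrary: C rule: borel_measurable_induct_real)
  case (set A)
  interpret prob_space "rep_measure x" by (rule prob_space_rep_measure[OF x])
  have A: "A \<in> mult_sets X V" using set by (simp add: sets_rep_measure)
  then have m: "multiplier (indicator A)" by (rule multiplier_indicator)
  have "0 \<le> extend (indicator A) x"
    using multiplier_extendable[OF m] x by (intro extend_nonneg) auto
  then have "measure (rep_measure x) A = extend (indicator A) x"
    by (simp add: measure_def emeasure_rep_measure[OF x A])
  moreover have "A \<inter> ext X = A" using mult_sets_subset[OF A] by auto
  ultimately show ?case using m by (simp add: space_rep_measure)
next
  case (mult u c)
  show ?case
  proof (cases "c = 0")
    case True
    then show ?thesis using x by (simp add: multiplier_const extend_const)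
  next
    case False
    then have "u y \<le> C / c" if "y \<in> ext X" for y
      using mult.prems[OF that] mult.hyps(1) by (simp add: field_simps)
    from mult.IH[OF this] show ?thesis
      using multiplier_mult[OF multiplier_const[of c], of u] x
      by (simp add: extend_scale multiplier_extendable)
  qed
next
  case (add u v)
  interpret prob_space "rep_measure x" by (rule prob_space_rep_measure[OF x])
  \<comment> \<open>Both summands are nonnegative, so each inherits the bound on their sum.\<close>
  have *: "u y \<le> C" "v y \<le> C" if "y \<in> ext X" for y
    using add.prems[OF that] add.hyps(2,4)[of y] by auto
  note IH = add.IH(1)[OF *(1)] add.IH(2)[OF *(2)]
  have "integrable (rep_measure x) u" "integrable (rep_measure x) v"
    using add.hyps * by (auto intro!: integrable_const_bound[of _ C] simp: space_rep_measure)
  then show ?case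
    using IH x multiplier_add[of v u]
    by (simp add: extend_add multiplier_extendable)
next
  case (seq U)
  interpret prob_space "rep_measure x" by (rule prob_space_rep_measure[OF x])
  have inc: "incseq (\<lambda>n. U n y)" for y
    using seq.hyps(3) by (auto simp: incseq_def le_fun_def)
  have lim: "(\<lambda>n. U n y) \<longlonglongrightarrow> u y" if "y \<in> ext X" for y
    using seq.hyps(4)[of y] that by (simp add: space_rep_measure)
  have bd: "U n y \<le> C" if "y \<in> ext X" for n y
    using incseq_le[OF inc lim[OF that], of n] seq.prems[OF that] by simp
  note IH = seq.IH[OF bd]
  have "multiplier u"
    by (rule multiplier_incseq_limit[of U C]) (use IH inc lim bd in auto)
  moreover have "(\<lambda>n. extend (U n) x) \<longlonglongrightarrow> extend u x"
    by (rule extend_incseq_limit(2)[of U C]) (use IH inc lim bd x multiplier_extendable in auto)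
  moreover have "(\<lambda>n. integral\<^sup>L (rep_measure x) (U n)) \<longlonglongrightarrow> integral\<^sup>L (rep_measure x) u"
    by (rule integral_dominated_convergence[where w = "\<lambda>_. C"])
      (use assms(1) seq.hyps lim bd in \<open>auto simp: space_rep_measure\<close>)
  ultimately show ?case using IH LIMSEQ_unique by simp
qed

lemma has_bochner_integral_rep_measure:
  assumes m: "m \<in> multipliers X V" and x: "x \<in> X"
  shows "has_bochner_integral (rep_measure x) m (m x)"
proof -
  interpret prob_space "rep_measure x" by (rule prob_space_rep_measure[OF x])
  note mV = multipliersD[OF m]
  obtain C where C: "C > 0" "\<And>y. y \<in> ext X \<Longrightarrow> \<bar>m y\<bar> \<le> C"
    using extendable_bounded[OF multiplier_extendable[OF mV(2)]] by blast
  have nn: "0 \<le> m y + C" "m y + C \<le> 2 * C" if "y \<in> ext X" for y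
    using C(2)[OF that] by auto
  have meas: "m \<in> borel_measurable (rep_measure x)"
    using mV(2) by (rule multiplier_measurable)
  then have int: "integrable (rep_measure x) m"
    by (rule integrable_const_bound[of _ C, rotated]) (use C in \<open>auto intro!: AE_I2 simp: space_rep_measure\<close>)
  \<comment> \<open>\<open>integral_rep_measure\<close> asks for nonnegativity at every point of the
    type. Adding \<open>C\<close> achieves it on \<open>ext X\<close>, and \<open>max 0\<close>
    enforces it elsewhere without changing any value on \<open>ext X\<close>.\<close>
  have "integral\<^sup>L (rep_measure x) (\<lambda>y. max 0 (m y + C)) = extend (\<lambda>y. max 0 (m y + C)) x"
    by (rule integral_rep_measure[of _ x "2 * C", THEN conjunct2])
      (use meas C(1) nn(2) x in auto)
  also have "extend (\<lambda>y. max 0 (m y + C)) x = m x + C"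
    using extend_eq[OF add_V[OF mV(1) const_V[of C]], of "\<lambda>y. max 0 (m y + C)" x] x C
    by (simp add: ext_imp_mem nn)
  also have "integral\<^sup>L (rep_measure x) (\<lambda>y. max 0 (m y + C)) = integral\<^sup>L (rep_measure x) (\<lambda>y. m y + C)"
    using C by (intro Bochner_Integration.integral_cong) (auto simp: space_rep_measure nn)
  also have "\<dots> = integral\<^sup>L (rep_measure x) m + C"
    using int prob_space by simp
  finally show ?thesis
    using int by (simp add: has_bochner_integral_iff)
qed

text \<open>Existence is the construction above. For uniqueness, the indicator of each measurable
  set extends to an element of \<open>multipliers X V\<close>, so the integral condition forces the
  measure of that set.\<close>

lemma mult_measure_eq:
  assumes x: "x \<in> X"
  shows "mult_measure X V x = rep_measure x"
  unfolding mult_measure_def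
proof (rule the_equality)
  show "prob_space (rep_measure x) \<and> space (rep_measure x) = ext X \<and>
      sets (rep_measure x) = mult_sets X V \<and>
      (\<forall>m\<in>multipliers X V. has_bochner_integral (rep_measure x) m (m x))"
    using x by (simp add: prob_space_rep_measure space_rep_measure sets_rep_measure
        has_bochner_integral_rep_measure)
next
  fix M
  assume M: "prob_space M \<and> space M = ext X \<and> sets M = mult_sets X V \<and>
      (\<forall>m\<in>multipliers X V. has_bochner_integral M m (m x))"
  interpret prob_space M using M by blast
  show "M = rep_measure x"
  proof (rule measure_eqI)
    show "sets M = sets (rep_measure x)" using M by (simp add: sets_rep_measure)
    fix A assume A: "A \<in> sets M"
    then have A': "A \<in> mult_sets X V" using M by simp
    then have ind: "multiplier (indicator A)" by (rule multiplier_indicator)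
    note e = extend[OF multiplier_extendable[OF ind]]
    have "multiplier (extend (indicator A))"
      using ind e(2) by (subst multiplier_cong[of _ "indicator A"]) auto
    with e(1) have "extend (indicator A) \<in> multipliers X V" by (rule multipliersI)
    with M have "extend (indicator A) x = integral\<^sup>L M (extend (indicator A))"
      by (metis has_bochner_integral_integral_eq)
    also have "\<dots> = integral\<^sup>L M (indicator A)"
      using M e(2) by (intro Bochner_Integration.integral_cong) auto
    also have "\<dots> = measure M A"
      using A by (simp add: Int_absorb2 sets.sets_into_space)
    finally show "emeasure M A = emeasure (rep_measure x) A"
      by (simp add: emeasure_rep_measure[OF x A'] emeasure_eq_measure)
  qed
qed

end

section \<open>Regularity of finite measures on generated sigma-algebras\<close>

text \<open>Induction on the generation of the sigma-algebra. Generators are approximated from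
  inside by continuity from below, and countable unions by combining approximations with summable
  errors.\<close>

lemma (in finite_measure) regular_sigma_sets:
  assumes G: "\<G> \<subseteq> sets M" and empty: "{} \<in> \<G>" and space: "space M \<in> \<G>"
    and Int: "\<And>A B. A \<in> \<G> \<Longrightarrow> B \<in> \<G> \<Longrightarrow> A \<inter> B \<in> \<G>"
    and UN: "\<And>A :: nat \<Rightarrow> 'a set. (\<And>n. A n \<in> \<G>) \<Longrightarrow> (\<Union>n. A n) \<in> \<G>"
    and inner: "\<And>A. A \<in> \<G> \<Longrightarrow> \<exists>C :: nat \<Rightarrow> 'a set.
      (\<forall>n. C n \<subseteq> space M \<and> space M - C n \<in> \<G>) \<and> incseq C \<and> A = (\<Union>n. C n)"
    and A: "A \<in> sigma_sets (space M) \<G>" and "0 < (e::real)"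
  shows "\<exists>F U. F \<subseteq> space M \<and> space M - F \<in> \<G> \<and> U \<in> \<G> \<and> F \<subseteq> A \<and> A \<subseteq> U \<and> measure M (U - F) < e"
  using A \<open>0 < e\<close>
proof (induction arbitrary: e)
  case (Basic A)
  then obtain C :: "nat \<Rightarrow> 'a set" where C: "\<And>n. C n \<subseteq> space M" "\<And>n. space M - C n \<in> \<G>"
    "incseq C" "A = (\<Union>n. C n)"
    using inner by metis
  have Cs: "C n \<in> sets M" for n
    using C(1,2) G by (metis Diff_Diff_Int Int_absorb1 sets.compl_sets subsetD)
  have As: "A \<in> sets M" using Basic G by auto
  have "(\<lambda>n. measure M (C n)) \<longlonglongrightarrow> measure M A"
    unfolding C(4) using Cs C(3) by (intro finite_Lim_measure_incseq) auto
  then have "\<forall>\<^sub>F n in sequentially. measure M A - e < measure M (C n)"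
    using Basic.prems by (intro order_tendstoD(1)) auto
  then obtain n where n: "measure M A - e < measure M (C n)"
    by (auto simp: eventually_sequentially)
  have CA: "C n \<subseteq> A" using C(4) by auto
  have "measure M (A - C n) = measure M A - measure M (C n)"
    by (rule finite_measure_Diff[OF As Cs CA])
  with n C Basic CA show ?case
    by (intro exI[of _ "C n"] exI[of _ A]) auto
next
  case Empty
  then show ?case
    using empty space by (intro exI[of _ "{}"]) auto
next
  case (Compl A)
  then obtain F U where FU: "F \<subseteq> space M" "space M - F \<in> \<G>" "U \<in> \<G>" "F \<subseteq> A" "A \<subseteq> U"
    "measure M (U - F) < e"
    by metis
  have US: "U \<subseteq> space M" using FU(3) G sets.sets_into_space by blast
  \<comment> \<open>Complementation exchanges the inner and the outer set and preserves the gap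
    between them.\<close>
  have "(space M - F) - (space M - U) = U - F" using US by auto
  with FU US show ?case
    by (intro exI[of _ "space M - U"] exI[of _ "space M - F"]) (auto simp: double_diff)
next
  case (Union A)
  \<comment> \<open>These errors add up to \<open>e / 2\<close>, which leaves room for a strict
    inequality after passing to a finite stage.\<close>
  have "\<exists>F U. F \<subseteq> space M \<and> space M - F \<in> \<G> \<and> U \<in> \<G> \<and> F \<subseteq> A n \<and> A n \<subseteq> U \<and>
      measure M (U - F) < e / 4 * (1/2) ^ n" for n
    using Union.IH[of "e / 4 * (1/2) ^ n" n] Union.prems by simp
  then obtain F U where F: "\<And>n. F n \<subseteq> space M" "\<And>n. space M - F n \<in> \<G>" "\<And>n. F n \<subseteq> A n"
    and U: "\<And>n. U n \<in> \<G>" "\<And>n. A n \<subseteq> U n"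
    and m: "\<And>n. measure M (U n - F n) < e / 4 * (1/2) ^ n"
    by metis
  have Us: "U n \<in> sets M" for n using U G by auto
  have Fs: "F n \<in> sets M" for n
    using F(1,2) G by (metis Diff_Diff_Int Int_absorb1 sets.compl_sets subsetD)
  \<comment> \<open>The inner sets are united only up to \<open>N\<close>, because
    \<open>\<G>\<close> is assumed closed under finite intersections only. Continuity from above
    shows that some \<open>N\<close> suffices.\<close>
  let ?U = "\<Union>n. U n" and ?F = "\<lambda>N. \<Union>n<N. F n"
  have "range (\<lambda>N. ?U - ?F N) \<subseteq> sets M"
    using Us Fs by auto
  moreover have "decseq (\<lambda>N. ?U - ?F N)"
    by (fastforce simp: decseq_def)
  ultimately have "(\<lambda>N. measure M (?U - ?F N)) \<longlonglongrightarrow> measure M (\<Inter>N. ?U - ?F N)"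
    by (rule finite_Lim_measure_decseq)
  moreover have "measure M (\<Inter>N. ?U - ?F N) < e"
  proof -
    have g: "(\<lambda>n. e / 4 * (1/2::real) ^ n) sums (e / 4 * 2)"
      using geometric_sums[of "1/2::real"] by (intro sums_mult) simp
    have s: "summable (\<lambda>n. measure M (U n - F n))"
      by (rule summable_comparison_test'[OF sums_summable[OF g], of 0]) (use m in \<open>auto intro: less_imp_le\<close>)
    have "(\<Inter>N. ?U - ?F N) \<subseteq> (\<Union>n. U n - F n)"
      by (auto; blast)
    then have "measure M (\<Inter>N. ?U - ?F N) \<le> measure M (\<Union>n. U n - F n)"
      using Us Fs by (intro finite_measure_mono) auto
    also have "\<dots> \<le> (\<Sum>n. measure M (U n - F n))"
      using Us Fs s by (intro finite_measure_subadditive_countably) auto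
    also have "\<dots> \<le> (\<Sum>n. e / 4 * (1/2) ^ n)"
      by (intro suminf_le s sums_summable[OF g] less_imp_le m)
    also have "\<dots> < e"
      using sums_unique[OF g] Union.prems by simp
    finally show ?thesis .
  qed
  ultimately have "\<forall>\<^sub>F N in sequentially. measure M (?U - ?F N) < e"
    by (rule order_tendstoD(2))
  then obtain N where N: "measure M (?U - ?F N) < e"
    by (auto simp: eventually_sequentially)
  have "space M - ?F N \<in> \<G>"
  proof (induction N)
    case 0
    then show ?case using space by simp
  next
    case (Suc N)
    have "space M - ?F (Suc N) = (space M - F N) \<inter> (space M - ?F N)"
      by (auto simp: less_Suc_eq)
    then show ?case using Int[OF F(2) Suc] by simp
  qed
  moreover have "?U \<in> \<G>" by (rule UN[OF U(1)])
  ultimately show ?case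
    using N F U by (intro exI[of _ "?F N"] exI[of _ ?U]) (auto; blast)
qed

section \<open>Linear and uniform closure properties of the monotone closure\<close>

lemma mu_closure_extensional:
  assumes "F \<subseteq> extensional X" "f \<in> mu_closure X F"
  shows "f \<in> extensional X"
  using assms(2) by cases (use assms(1) in auto)

lemma mu_closure_bounded:
  assumes F: "\<And>f. f \<in> F \<Longrightarrow> \<exists>C::real. \<forall>x\<in>X. \<bar>f x\<bar> \<le> C" and f: "f \<in> mu_closure X F"
  shows "\<exists>C. \<forall>x\<in>X. \<bar>f x\<bar> \<le> C"
  using f
proof cases
  case base
  then show ?thesis by (rule F)
next
  case (lim s C)
  have "\<bar>f x\<bar> \<le> C" if "x \<in> X" for x
    using lim(3) that by (intro LIMSEQ_le_const2[OF tendsto_rabs[OF bspec[OF lim(5) that]]]) blast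
  then show ?thesis by blast
qed

text \<open>A negative \<open>c\<close> reverses the direction of a monotone sequence;
  \<open>mu_closure.lim\<close> admits both directions.\<close>

lemma mu_closure_scale:
  assumes F: "\<And>f. f \<in> F \<Longrightarrow> (\<lambda>x\<in>X. c * f x) \<in> F" and f: "f \<in> mu_closure X F"
  shows "(\<lambda>x\<in>X. c * f x) \<in> mu_closure X F"
  using f
proof induction
  case (base f)
  then show ?case by (intro mu_closure.base F)
next
  case (lim s C f)
  show ?case
  proof (rule mu_closure.lim)
    show "(\<lambda>x\<in>X. c * s n x) \<in> mu_closure X F" for n by (rule lim)
    show "(\<forall>x\<in>X. incseq (\<lambda>n. (\<lambda>x\<in>X. c * s n x) x)) \<or> (\<forall>x\<in>X. decseq (\<lambda>n. (\<lambda>x\<in>X. c * s n x) x))"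
      using lim.hyps(2)
      by (cases "0 \<le> c") (auto simp: incseq_def decseq_def intro: mult_left_mono mult_left_mono_neg)
    show "\<forall>n. \<forall>x\<in>X. \<bar>(\<lambda>x\<in>X. c * s n x) x\<bar> \<le> \<bar>c\<bar> * C"
      using lim.hyps(3) by (auto simp: abs_mult intro: mult_left_mono)
    show "\<forall>x\<in>X. (\<lambda>n. (\<lambda>x\<in>X. c * s n x) x) \<longlonglongrightarrow> (\<lambda>x\<in>X. c * f x) x"
      using lim.hyps(5) by (auto intro: tendsto_mult_left)
  qed (rule restrict_extensional)
qed

lemma mu_closure_add_bounded:
  assumes f: "f \<in> mu_closure X F" and h: "\<And>g. g \<in> F \<Longrightarrow> (\<lambda>x\<in>X. g x + h x) \<in> mu_closure X F"
    and hb: "\<forall>x\<in>X. \<bar>h x\<bar> \<le> K"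
  shows "(\<lambda>x\<in>X. f x + h x) \<in> mu_closure X F"
  using f
proof induction
  case (base f)
  then show ?case by (rule h)
next
  case (lim s C f)
  show ?case
  proof (rule mu_closure.lim)
    show "(\<lambda>x\<in>X. s n x + h x) \<in> mu_closure X F" for n by (rule lim)
    show "(\<forall>x\<in>X. incseq (\<lambda>n. (\<lambda>x\<in>X. s n x + h x) x)) \<or> (\<forall>x\<in>X. decseq (\<lambda>n. (\<lambda>x\<in>X. s n x + h x) x))"
      using lim.hyps(2) by (auto simp: incseq_def decseq_def)
    show "\<forall>n. \<forall>x\<in>X. \<bar>(\<lambda>x\<in>X. s n x + h x) x\<bar> \<le> C + K"
      using lim.hyps(3) hb by (auto intro!: order_trans[OF abs_triangle_ineq] add_mono)
    show "\<forall>x\<in>X. (\<lambda>n. (\<lambda>x\<in>X. s n x + h x) x) \<longlonglongrightarrow> (\<lambda>x\<in>X. f x + h x) x"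
      using lim.hyps(5) by (auto intro: tendsto_add)
  qed (rule restrict_extensional)
qed

text \<open>Sums of sequences with opposite directions need not be monotone, so one summand is kept
  fixed during each induction: first an element of \<open>F\<close>, then an arbitrary element of
  the closure.\<close>

lemma mu_closure_add:
  assumes add: "\<And>f g. f \<in> F \<Longrightarrow> g \<in> F \<Longrightarrow> (\<lambda>x\<in>X. f x + g x) \<in> F"
    and bd: "\<And>f. f \<in> F \<Longrightarrow> \<exists>C::real. \<forall>x\<in>X. \<bar>f x\<bar> \<le> C"
    and f: "f \<in> mu_closure X F" and g: "g \<in> mu_closure X F"
  shows "(\<lambda>x\<in>X. f x + g x) \<in> mu_closure X F"
proof -
  have 1: "(\<lambda>x\<in>X. h x + k x) \<in> mu_closure X F" if "h \<in> F" "k \<in> mu_closure X F" for h k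
  proof -
    obtain K where K: "\<forall>x\<in>X. \<bar>h x\<bar> \<le> K" using bd[OF \<open>h \<in> F\<close>] by blast
    have "(\<lambda>x\<in>X. k x + h x) \<in> mu_closure X F"
      by (rule mu_closure_add_bounded[OF that(2) _ K]) (intro mu_closure.base add that)
    then show ?thesis by (simp add: add.commute)
  qed
  obtain K where K: "\<forall>x\<in>X. \<bar>g x\<bar> \<le> K" using mu_closure_bounded[OF bd g] by blast
  show ?thesis
    by (rule mu_closure_add_bounded[OF f _ K]) (rule 1[OF _ g])
qed

text \<open>Shifting the n-th term of a rapidly converging sequence down by \<open>2 / 2 ^ n\<close> makes it increasing.\<close>
lemma mu_closure_uniform_limit:
  assumes add: "\<And>f g. f \<in> F \<Longrightarrow> g \<in> F \<Longrightarrow> (\<lambda>x\<in>X. f x + g x) \<in> F"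
    and bd: "\<And>f. f \<in> F \<Longrightarrow> \<exists>C::real. \<forall>x\<in>X. \<bar>f x\<bar> \<le> C"
    and const: "\<And>c. (\<lambda>x\<in>X. c) \<in> F"
    and g: "g \<in> extensional X"
    and approx: "\<And>e. e > 0 \<Longrightarrow> \<exists>f\<in>mu_closure X F. \<forall>x\<in>X. \<bar>f x - g x\<bar> \<le> e"
  shows "g \<in> mu_closure X F"
proof -
  have "\<exists>f\<in>mu_closure X F. \<forall>x\<in>X. \<bar>f x - g x\<bar> \<le> (1/2)^n / 2" for n
    by (rule approx) simp
  then obtain f where f: "\<And>n. f n \<in> mu_closure X F" "\<And>n x. x \<in> X \<Longrightarrow> \<bar>f n x - g x\<bar> \<le> (1/2)^n / 2"
    by metis
  define s where "s n = (\<lambda>x\<in>X. f n x + (\<lambda>x\<in>X. - (2 * (1/2)^n)) x)" for n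
  obtain K where K: "\<And>x. x \<in> X \<Longrightarrow> \<bar>f 0 x\<bar> \<le> K"
    using mu_closure_bounded[OF bd f(1)] by blast
  have pow: "(1/2::real)^n \<le> 1" for n by (simp add: power_le_one)
  show ?thesis
  proof (rule mu_closure.lim)
    show "s n \<in> mu_closure X F" for n
      unfolding s_def by (intro mu_closure_add add bd f mu_closure.base const)
    \<comment> \<open>From \<open>n\<close> to \<open>Suc n\<close> the value of \<open>f\<close>
      drops by at most \<open>3/4 * (1/2)^n\<close>, while the downward shift shrinks by
      \<open>(1/2)^n\<close>.\<close>
    have "s n x \<le> s (Suc n) x" if "x \<in> X" for n x
    proof -
      have "0 \<le> (1/2::real)^n" by simp
      with f(2)[OF that, of n] f(2)[OF that, of "Suc n"] have "f n x - 2 * (1/2)^n \<le> f (Suc n) x - (1/2)^n"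
        unfolding power_Suc by linarith
      then show ?thesis using that by (simp add: s_def)
    qed
    then show "(\<forall>x\<in>X. incseq (\<lambda>n. s n x)) \<or> (\<forall>x\<in>X. decseq (\<lambda>n. s n x))"
      by (auto intro: incseq_SucI)
    \<comment> \<open>Both \<open>f n\<close> and \<open>f 0\<close> are within \<open>1/2\<close>
      of \<open>g\<close>, and the shift is at most \<open>2\<close>.\<close>
    have "\<bar>s n x\<bar> \<le> K + 3" if "x \<in> X" for n x
    proof -
      have "0 \<le> (1/2::real)^n" by simp
      with f(2)[OF that, of n] f(2)[OF that, of 0] K[OF that] pow[of n]
      have "\<bar>f n x - 2 * (1/2)^n\<bar> \<le> K + 3"
        unfolding power_0 by linarith
      then show ?thesis using that by (simp add: s_def)
    qed
    then show "\<forall>n. \<forall>x\<in>X. \<bar>s n x\<bar> \<le> K + 3" by blast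
    show "\<forall>x\<in>X. (\<lambda>n. s n x) \<longlonglongrightarrow> g x"
    proof
      fix x assume x: "x \<in> X"
      have p: "(\<lambda>n. (1/2::real)^n) \<longlonglongrightarrow> 0" by (rule LIMSEQ_realpow_zero) auto
      have "(\<lambda>n. f n x - g x) \<longlonglongrightarrow> 0"
        by (rule Lim_null_comparison[of _ "\<lambda>n. (1/2)^n / 2"]) (use f(2)[OF x] tendsto_divide[OF p tendsto_const[of 2]] in auto)
      then have "(\<lambda>n. f n x - 2 * (1/2)^n) \<longlonglongrightarrow> g x - 2 * 0"
        by (intro tendsto_intros p) (simp add: LIM_zero_iff)
      then show "(\<lambda>n. s n x) \<longlonglongrightarrow> g x" using x by (simp add: s_def)
    qed
  qed (fact g)
qed

section \<open>Intermediate function spaces as extremal function spaces\<close>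

lemma determined_by_extreme_points_nonneg:
  assumes det: "determined_by_extreme_points X V" and const: "\<And>c. (\<lambda>x\<in>X. c) \<in> V"
    and f: "f \<in> V" "\<forall>y\<in>ext X. 0 \<le> f y" and x: "x \<in> X"
  shows "0 \<le> f x"
proof -
  \<comment> \<open>If there were no extreme points, the single real \<open>Inf {}\<close> would be
    a lower bound of every constant.\<close>
  have "ext X \<noteq> {}"
  proof
    assume "ext X = {}"
    then have "Inf {} \<le> c" for c :: real
      using det const[of c] x by (fastforce simp: determined_by_extreme_points_def)
    from this[of "Inf {} - 1"] show False by simp
  qed
  then have "0 \<le> Inf (f ` ext X)"
    using f(2) by (intro cInf_greatest) auto
  also have "\<dots> \<le> f x"
    using det f(1) x by (auto simp: determined_by_extreme_points_def)
  finally show ?thesis .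
qed

lemma A_b_iff:
  "f \<in> A_b X \<longleftrightarrow> f \<in> extensional X \<and> (\<exists>C. \<forall>x\<in>X. \<bar>f x\<bar> \<le> C) \<and> affine_fun_on X f"
proof -
  have "Met_TC.mbounded (f ` X) \<longleftrightarrow> bounded (f ` X)"
    by (auto simp: Met_TC.mbounded_def bounded_def subset_iff)
  then show ?thesis
    by (auto simp: A_b_def Met_TC.fspace_def bounded_iff)
qed

text \<open>Closedness of \<open>H\<close> is relative to \<open>A_b X\<close>, so a uniform limit
  has to be placed in \<open>A_b X\<close> first. Convexity puts the convex combinations back in
  \<open>X\<close>, where the approximation holds.\<close>

lemma A_b_uniform_limit:
  assumes X: "convex X" and g: "g \<in> extensional X"
    and approx: "\<And>e. e > 0 \<Longrightarrow> \<exists>f\<in>A_b X. \<forall>x\<in>X. \<bar>f x - g x\<bar> \<le> e"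
  shows "g \<in> A_b X"
proof -
  obtain f C where f: "\<forall>x\<in>X. \<bar>f x - g x\<bar> \<le> 1" "\<forall>x\<in>X. \<bar>f x\<bar> \<le> C"
    using approx[of 1] by (auto simp: A_b_iff)
  have "\<bar>g x\<bar> \<le> C + 1" if "x \<in> X" for x
    using bspec[OF f(1) that] bspec[OF f(2) that] by linarith
  moreover have "g ((1 - t) *\<^sub>R x + t *\<^sub>R y) = (1 - t) * g x + t * g y"
    if xy: "x \<in> X" "y \<in> X" and t: "t \<in> {0..1}" for x y t
  proof -
    let ?z = "(1 - t) *\<^sub>R x + t *\<^sub>R y"
    have z: "?z \<in> X"
      using X xy t by (auto simp: convex_alt)
    have "\<bar>g ?z - ((1 - t) * g x + t * g y)\<bar> \<le> 0 + e" if "e > 0" for e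
    proof -
      obtain f where f: "f \<in> A_b X" "\<And>x. x \<in> X \<Longrightarrow> \<bar>f x - g x\<bar> \<le> e / 2"
        using approx[of "e / 2"] \<open>e > 0\<close> by auto
      have "f ?z = (1 - t) * f x + t * f y"
        using f(1) xy t unfolding A_b_iff affine_fun_on_def by blast
      then have "g ?z - ((1 - t) * g x + t * g y) =
          (g ?z - f ?z) + ((1 - t) * (f x - g x) + t * (f y - g y))"
        by (simp add: algebra_simps)
      moreover have "\<bar>(1 - t) * (f x - g x) + t * (f y - g y)\<bar> \<le> e / 2"
      proof -
        have "\<bar>(1 - t) * (f x - g x) + t * (f y - g y)\<bar> \<le> (1 - t) * \<bar>f x - g x\<bar> + t * \<bar>f y - g y\<bar>"
          using t by (intro order_trans[OF abs_triangle_ineq]) (simp add: abs_mult)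
        also have "\<dots> \<le> (1 - t) * (e / 2) + t * (e / 2)"
          using t f(2) xy by (intro add_mono mult_left_mono) auto
        also have "\<dots> = e / 2"
          by (simp add: field_simps)
        finally show ?thesis .
      qed
      ultimately show ?thesis
        using f(2)[OF z] by linarith
    qed
    then have "\<bar>g ?z - ((1 - t) * g x + t * g y)\<bar> \<le> 0"
      by (rule field_le_epsilon)
    then show ?thesis by simp
  qed
  ultimately show ?thesis
    using g unfolding A_b_iff affine_fun_on_def by (intro conjI exI[of _ "C + 1"] ballI)
qed

text \<open>A limit outside \<open>H\<close> would have a ball of some radius \<open>r\<close>
  disjoint from a closed set containing \<open>H\<close>, yet an approximant within
  \<open>r / 2\<close> lies in that ball.\<close>

lemma intermediate_function_space_uniform_limit:
  assumes X: "convex X" and H: "intermediate_function_space X H" and g: "g \<in> extensional X"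
    and approx: "\<And>e. e > 0 \<Longrightarrow> \<exists>f\<in>H. \<forall>x\<in>X. \<bar>f x - g x\<bar> \<le> e"
  shows "g \<in> H"
proof (rule ccontr)
  assume "g \<notin> H"
  let ?m = "funspace X (euclidean_metric :: real metric)"
  have sub: "H \<subseteq> A_b X" using H by (simp add: intermediate_function_space_def)
  have gA: "g \<in> A_b X"
    by (rule A_b_uniform_limit[OF X g]) (meson approx sub subsetD)
  \<comment> \<open>\<open>T\<close> is closed among all bounded functions and has trace
    \<open>H\<close> on \<open>A_b X\<close>.\<close>
  obtain T where T: "closedin (mtopology_of ?m) T" "H = T \<inter> A_b X"
    using H by (auto simp: intermediate_function_space_def mtopology_of_submetric closedin_subtopology)
  interpret M: Metric_space "mspace ?m" "mdist ?m" by (rule Metric_space_mspace_mdist)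
  have "closedin M.mtopology T"
    using T(1) by (simp only: mtopology_of_def)
  moreover have gM: "g \<in> mspace ?m" "g \<notin> T"
    using gA T(2) \<open>g \<notin> H\<close> by (auto simp: A_b_def)
  ultimately obtain r where r: "r > 0" "disjnt T (M.mball g r)"
    unfolding M.closedin_metric by auto
  obtain f where f: "f \<in> H" "\<forall>x\<in>X. \<bar>f x - g x\<bar> \<le> r / 2"
    using approx[of "r / 2"] r by auto
  have fM: "f \<in> mspace ?m"
    using f(1) sub by (auto simp: A_b_def)
  have "(SUP x\<in>X. dist (g x) (f x)) \<le> r / 2" if "X \<noteq> {}"
    using f(2) that by (intro cSUP_least) (auto simp: dist_real_def abs_minus_commute)
  then have "mdist ?m g f \<le> r / 2"
    using r(1) by (simp add: Met_TC.fdist_def)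
  then have "f \<in> M.mball g r"
    using gM fM r(1) unfolding M.in_mball by simp
  with r(2) f(1) T(2) show False
    by (auto simp: disjnt_iff)
qed

lemma intermediate_extremal_function_space:
  assumes X: "convex X" and H: "intermediate_function_space X H"
    and det: "determined_by_extreme_points X H"
  shows "extremal_function_space X H"
proof
  have sub: "H \<subseteq> A_b X" "A_c X \<subseteq> H" and lin: "linear_subspace_on X H"
    using H by (auto simp: intermediate_function_space_def)
  show "H \<subseteq> extensional X" using sub A_b_iff by blast
  show "\<exists>C. \<forall>x\<in>X. \<bar>f x\<bar> \<le> C" if "f \<in> H" for f
    using sub that A_b_iff by blast
  have "(\<lambda>x\<in>X. c) \<in> A_c X" for c
    using X by (auto simp: A_c_def affine_fun_on_def convex_alt algebra_simps)
  with sub show const: "(\<lambda>x\<in>X. c) \<in> H" for c by blast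
  show "(\<lambda>x\<in>X. f x + g x) \<in> H" if "f \<in> H" "g \<in> H" for f g
    using lin that by (simp add: linear_subspace_on_def)
  show "(\<lambda>x\<in>X. c * f x) \<in> H" if "f \<in> H" for f c
    using lin that by (simp add: linear_subspace_on_def)
  show "g \<in> H" if "g \<in> extensional X" "\<And>e. e > 0 \<Longrightarrow> \<exists>f\<in>H. \<forall>x\<in>X. \<bar>f x - g x\<bar> \<le> e" for g
    using intermediate_function_space_uniform_limit[OF X H that] .
  show "0 \<le> f x" if "f \<in> H" "\<forall>y\<in>ext X. 0 \<le> f y" "x \<in> X" for f x
    using determined_by_extreme_points_nonneg[OF det const that] .
qed

section \<open>The monotone closure of \<open>H\<close> and its multipliers\<close>

lemma mu_closure_monotone_extremal_function_space:
  assumes "extremal_function_space X H" and det: "determined_by_extreme_points X (mu_closure X H)"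
  shows "monotone_extremal_function_space X (mu_closure X H)"
proof -
  interpret extremal_function_space X H by fact
  show ?thesis
  proof
    show "mu_closure X H \<subseteq> extensional X"
      using mu_closure_extensional[OF extensional_V] by blast
    show "\<exists>C. \<forall>x\<in>X. \<bar>f x\<bar> \<le> C" if "f \<in> mu_closure X H" for f
      using mu_closure_bounded[OF bounded_V that] .
    show const: "(\<lambda>x\<in>X. c) \<in> mu_closure X H" for c
      by (intro mu_closure.base const_V)
    show "(\<lambda>x\<in>X. f x + g x) \<in> mu_closure X H" if "f \<in> mu_closure X H" "g \<in> mu_closure X H" for f g
      using mu_closure_add[OF add_V bounded_V that] .
    show "(\<lambda>x\<in>X. c * f x) \<in> mu_closure X H" if "f \<in> mu_closure X H" for f c
      using mu_closure_scale[OF scale_V that] .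
    show "g \<in> mu_closure X H" if "g \<in> extensional X"
      "\<And>e. e > 0 \<Longrightarrow> \<exists>f\<in>mu_closure X H. \<forall>x\<in>X. \<bar>f x - g x\<bar> \<le> e" for g
      using mu_closure_uniform_limit[OF add_V bounded_V const_V that] .
    show "0 \<le> f x" if "f \<in> mu_closure X H" "\<forall>y\<in>ext X. 0 \<le> f y" "x \<in> X" for f x
      using determined_by_extreme_points_nonneg[OF det const that] .
    show "f \<in> mu_closure X H" if "\<And>n. s n \<in> mu_closure X H" "\<forall>x\<in>X. incseq (\<lambda>n. s n x)"
      "\<forall>n. \<forall>x\<in>X. \<bar>s n x\<bar> \<le> C" "f \<in> extensional X" "\<forall>x\<in>X. (\<lambda>n. s n x) \<longlonglongrightarrow> f x" for s C f
      using that(2) by (intro mu_closure.lim[OF that(1) _ that(3-5)] disjI1)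
  qed
qed

text \<open>For the nonnegative shift \<open>v\<close> of \<open>u\<close>, the functions
  \<open>f\<close> with \<open>v * f\<close> extendable to the closure include \<open>H\<close> and
  are stable under bounded monotone limits, which is an induction over
  \<open>mu_closure\<close>.\<close>

lemma multiplier_mu_closure:
  assumes "extremal_function_space X H" "monotone_extremal_function_space X (mu_closure X H)"
    and u: "extremal_function_space.multiplier X H u"
  shows "extremal_function_space.multiplier X (mu_closure X H) u"
proof -
  interpret h: extremal_function_space X H by fact
  interpret k: monotone_extremal_function_space X "mu_closure X H" by fact
  obtain C where C: "\<And>y. y \<in> ext X \<Longrightarrow> \<bar>u y\<bar> \<le> C"
    using h.extendable_bounded[OF h.multiplier_extendable[OF u]] by metis
  define v where "v y = u y + C" for y
  have v: "h.multiplier v"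
    unfolding v_def by (intro h.multiplier_add h.multiplier_const u)
  have v_bd: "0 \<le> v y" "v y \<le> 2 * C" if "y \<in> ext X" for y
    using C[OF that] by (auto simp: v_def)
  have vf: "k.extendable (\<lambda>y. v y * f y)" if "f \<in> mu_closure X H" for f
    using that
  proof induction
    case (base f)
    then have "h.extendable f" by (auto intro: h.extendableI)
    from h.multiplierD[OF v this] show ?case
      by (auto simp: h.extendable_def k.extendable_def intro: mu_closure.base)
  next
    case (lim s K f)
    \<comment> \<open>Stated for an arbitrary sequence \<open>t\<close> with limit \<open>g\<close>,
      so that decreasing sequences are covered by passing to \<open>- s\<close> and
      \<open>- f\<close>.\<close>
    have *: "k.extendable (\<lambda>y. v y * g y)"
      if "\<And>n. k.extendable (\<lambda>y. v y * t n y)" "\<forall>x\<in>X. incseq (\<lambda>n. t n x)"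
        "\<forall>n. \<forall>x\<in>X. \<bar>t n x\<bar> \<le> K" "\<forall>x\<in>X. (\<lambda>n. t n x) \<longlonglongrightarrow> g x" for t g
    proof (rule k.extend_incseq_limit(1)[of "\<lambda>n y. v y * t n y" "2 * C * K"])
      fix y assume y: "y \<in> ext X"
      note yX = ext_imp_mem[OF y]
      show "incseq (\<lambda>n. v y * t n y)"
        using v_bd[OF y] that(2) yX by (auto simp: incseq_def intro: mult_left_mono)
      have "t n y \<le> K" "0 \<le> K" for n
        using that(3) yX abs_ge_zero[of "t n y"] by (auto dest!: spec[of _ n] bspec[of X _ y] simp: abs_le_iff)
      then have "v y * t n y \<le> v y * K" "v y * K \<le> 2 * C * K" for n
        using v_bd[OF y] by (auto intro: mult_left_mono mult_right_mono)
      then show "v y * t n y \<le> 2 * C * K" for n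
        using order_trans by blast
      show "(\<lambda>n. v y * t n y) \<longlonglongrightarrow> v y * g y"
        using that(4) yX by (intro tendsto_mult_left) auto
    qed (fact that(1))
    from lim.hyps(2) show ?case
    proof
      assume "\<forall>x\<in>X. incseq (\<lambda>n. s n x)"
      then show ?thesis by (rule *[OF lim.IH _ lim.hyps(3,5)])
    next
      assume "\<forall>x\<in>X. decseq (\<lambda>n. s n x)"
      moreover have "k.extendable (\<lambda>y. v y * - s n y)" for n
        using k.extendable_scale[OF lim.IH[of n], of "-1"] by simp
      ultimately have "k.extendable (\<lambda>y. v y * - f y)"
        using lim.hyps(3,5) by - (rule *[of "\<lambda>n x. - s n x"], auto simp: decseq_def incseq_def intro: tendsto_minus)
      from k.extendable_scale[OF this, of "-1"] show ?thesis by simp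
    qed
  qed
  show ?thesis
    unfolding k.multiplier_def
  proof (intro allI impI)
    fix a assume a: "k.extendable a"
    then obtain f where f: "f \<in> mu_closure X H" "\<And>y. y \<in> ext X \<Longrightarrow> f y = a y"
      by (metis k.extendableE)
    \<comment> \<open>Subtracting \<open>C * a\<close> undoes the shift from \<open>u\<close> to
      \<open>v\<close>.\<close>
    have "k.extendable (\<lambda>y. v y * f y - C * a y)"
      by (intro k.extendable_diff k.extendable_scale vf f a)
    then show "k.extendable (\<lambda>y. u y * a y)"
      by (subst k.extendable_cong[of _ "\<lambda>y. v y * f y - C * a y"])
        (auto simp: v_def f(2) algebra_simps)
  qed
qed

section \<open>Inclusion of the generated sigma-algebra and regularity of the measure\<close>

theorem theorem8p10:
  fixes X :: "'a::locally_convex_space set" and H :: "('a \<Rightarrow> real) set" and x :: 'a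
  assumes "compact X" and "convex X"
    and "intermediate_function_space X H"
    and "determined_by_extreme_points X (mu_closure X H)"
    and "x \<in> X"
  shows "sigma_sets (ext X) (mult_sets X H) \<subseteq> mult_sets X (mu_closure X H) \<and>
    (\<forall>A \<in> sigma_sets (ext X) (mult_sets X H). \<forall>\<epsilon>::real. \<epsilon> > 0 \<longrightarrow>
      (\<exists>F G. F \<subseteq> ext X \<and> G \<subseteq> ext X \<and>
        ext X - F \<in> mult_sets X H \<and> G \<in> mult_sets X H \<and>
        F \<subseteq> A \<and> A \<subseteq> G \<and>
        measure (mult_measure X (mu_closure X H) x) (G - F) < \<epsilon>))"
proof -
  have "determined_by_extreme_points X H"
    using assms(4) by (simp add: determined_by_extreme_points_def mu_closure.base)
  then have eH: "extremal_function_space X H"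
    by (rule intermediate_extremal_function_space[OF assms(2,3)])
  then have mK: "monotone_extremal_function_space X (mu_closure X H)"
    using assms(4) by (rule mu_closure_monotone_extremal_function_space)
  interpret h: extremal_function_space X H by (rule eH)
  interpret k: monotone_extremal_function_space X "mu_closure X H" by (rule mK)
  have sub: "mult_sets X H \<subseteq> mult_sets X (mu_closure X H)"
  proof
    fix A assume "A \<in> mult_sets X H"
    then obtain u where "h.multiplier u" "A = {y \<in> ext X. 0 < u y}"
      unfolding h.mult_sets_iff by blast
    then show "A \<in> mult_sets X (mu_closure X H)"
      unfolding k.mult_sets_iff using multiplier_mu_closure[OF eH mK] by blast
  qed
  interpret M: prob_space "k.rep_measure x" by (rule k.prob_space_rep_measure[OF assms(5)])
  have inner: "\<exists>C :: nat \<Rightarrow> 'a set. (\<forall>n. C n \<subseteq> ext X \<and> ext X - C n \<in> mult_sets X H) \<and>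
      incseq C \<and> A = (\<Union>n. C n)" if "A \<in> mult_sets X H" for A
    by (rule h.mult_sets_inner[OF that]) blast
  show ?thesis
    unfolding k.mult_measure_eq[OF assms(5)]
  proof (intro conjI ballI allI impI)
    show "sigma_sets (ext X) (mult_sets X H) \<subseteq> mult_sets X (mu_closure X H)"
      by (rule sigma_algebra.sigma_sets_subset[OF k.sigma_algebra_mult_sets sub])
    fix A and \<epsilon> :: real
    assume A: "A \<in> sigma_sets (ext X) (mult_sets X H)" and "\<epsilon> > 0"
    \<comment> \<open>The generating family comes from \<open>H\<close> and the measure from its
      monotone closure; \<open>sub\<close> makes the generators measurable.\<close>
    have "\<exists>F U. F \<subseteq> ext X \<and> ext X - F \<in> mult_sets X H \<and> U \<in> mult_sets X H \<and>
        F \<subseteq> A \<and> A \<subseteq> U \<and> measure (k.rep_measure x) (U - F) < \<epsilon>"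
      by (rule M.regular_sigma_sets[of "mult_sets X H", unfolded k.space_rep_measure k.sets_rep_measure])
        (fact sub h.mult_sets_empty h.mult_sets_space h.mult_sets_Int h.mult_sets_UN inner A \<open>\<epsilon> > 0\<close>)+
    then obtain F U where FU: "F \<subseteq> ext X" "ext X - F \<in> mult_sets X H" "U \<in> mult_sets X H"
      "F \<subseteq> A" "A \<subseteq> U" "measure (k.rep_measure x) (U - F) < \<epsilon>"
      by (elim exE conjE)
    moreover have "U \<subseteq> ext X" using FU(3) by (rule h.mult_sets_subset)
    ultimately show "\<exists>F G. F \<subseteq> ext X \<and> G \<subseteq> ext X \<and>
        ext X - F \<in> mult_sets X H \<and> G \<in> mult_sets X H \<and>
        F \<subseteq> A \<and> A \<subseteq> G \<and> measure (k.rep_measure x) (G - F) < \<epsilon>"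
      by (intro exI[of _ F] exI[of _ U] conjI)
  qed
qed

end
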